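(* Let $\sigma>0$, $\alpha>1$ and $\epsilon>0$ (with $\epsilon<\alpha$), and let the displacement vectors in $\mathbb{R}^n$ have i.i.d. coordinates with the symmetric exponential density $f(x)=\frac{\sqrt2}{2\sigma}\exp\left(-\frac{\sqrt2|x|}{\sigma}\right)$, $x\in\mathbb{R}$ (this noise is denoted $\mathcal{D}$). For each $n$, let $\widetilde\mu^n$ be the hard-exclusion (Matérn) point process obtained from a homogeneous Poisson point process on $\mathbb{R}^n$ of intensity $\lambda_n=e^{nR}$, $R=-\ln(\sqrt2e\sigma\alpha)$, by deleting every point that has another point of the Poisson process at $L_1$ distance less than $r_n=\frac{n\sigma}{\sqrt2}(\alpha-\epsilon)$. Let decoding be maximum likelihood, with decoding regions $\mathcal{L}(\mathcal{D})$, let $p_e(n)$ be the probability of error, and let $\underline{\pi}(\mathrm{Mat},\mathcal{L}(\mathcal{D}),\alpha,\mathcal{D})=\liminf_{n\to\infty}-\frac1n\ln p_e(n)$ be the error exponent associated with this sequence of Matérn point processes. Then $$\underline{\pi}(\mathrm{Mat},\mathcal{L}(\mathcal{D}),\alpha,\mathcal{D})\ \ge\ \begin{cases}\alpha-\ln(\alpha)-1&\text{for }\alpha\le2,\\ \ln(\alpha)+1-2\ln(2)&\text{for }2\le\alpha\le4,\\ \frac{\alpha}{2}-\ln(\alpha)-1+2\ln(2)&\text{for }\alpha\ge4.\end{cases}$$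
   Context: Logarithms are natural; $|\cdot|_1$ is the $L_1$ norm. The intensity of $\widetilde\mu^n$ is $\widetilde\lambda_n=\lambda_n\exp\bigl(-\lambda_n(2r_n)^n/n!\bigr)$; one has $\widetilde\lambda_n\le\lambda_n$ and $\widetilde\lambda_n/\lambda_n\to1$. Write $\widetilde\mu^n=\sum_k\epsilon_{T_k^n}$ with $\epsilon_x$ the Dirac mass at $x$; each point carries a displacement vector $D_k^n$, i.i.d. in $k$ and independent of $\widetilde\mu^n$. Maximum likelihood decoding: the decoding region $\mathcal{L}_k^n$ of $T_k^n$ consists of those $x$ with $|x-T_k^n|_1<\inf_{l\neq k}|x-T_l^n|_1$, together with those ambiguous locations $x$ (for which no point is such a strict minimizer) lying in the Euclidean Voronoi cell of $T_k^n$. Under the Palm probability $\widetilde{\mathbb{P}}_0^n$ of $\widetilde\mu^n$ ($T_0^n=0$), $p_e(n)=\widetilde{\mathbb{P}}_0^n(D_0^n\notin\mathcal{L}_0^n)$.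
   Formalization: For α > 4 the bound is proved under the added assumption ε ≤ 1; without a smallness condition on ε it fails there (e.g. α = 10, ε = 9.9, where the exponent is the Poisson value ln α + 1 − 2 ln 2). For α ≤ 4 all ε in (0, α) are covered. *)

theory Defs
  imports "HOL-Probability.Probability"
begin

text \<open>
  The dimension varies inside the statement, so a point of n-dimensional space is a function
  that is extensional on the index set \<open>{..<n}\<close>, and the product measure \<open>euc n\<close> is Lebesgue
  measure on that space.
\<close>

type_synonym pt = "nat \<Rightarrow> real"

definition euc :: "nat \<Rightarrow> pt measure" where
  "euc n = (\<Pi>\<^sub>M i\<in>{..<n}. lborel)"

definition origin :: "nat \<Rightarrow> pt" where
  "origin n = (\<lambda>i\<in>{..<n}. 0)"

definition vdiff :: "nat \<Rightarrow> pt \<Rightarrow> pt \<Rightarrow> pt" where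
  "vdiff n x y = (\<lambda>i\<in>{..<n}. x i - y i)"

definition norm1 :: "nat \<Rightarrow> pt \<Rightarrow> real" where
  "norm1 n x = (\<Sum>i<n. \<bar>x i\<bar>)"

definition norm2 :: "nat \<Rightarrow> pt \<Rightarrow> real" where
  "norm2 n x = L2_set x {..<n}"

definition bounded_borel :: "nat \<Rightarrow> pt set \<Rightarrow> bool" where
  "bounded_borel n B \<longleftrightarrow> B \<in> sets (euc n) \<and> (\<exists>c. \<forall>x\<in>B. norm1 n x \<le> c)"

text \<open>A simple point process is represented by its random, locally finite set of points.\<close>

definition simple_point_process :: "'w measure \<Rightarrow> nat \<Rightarrow> ('w \<Rightarrow> pt set) \<Rightarrow> bool" where
  "simple_point_process M n \<Phi> \<longleftrightarrow>
     (\<forall>\<omega>\<in>space M. \<Phi> \<omega> \<subseteq> space (euc n)) \<and>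
     (\<forall>B. bounded_borel n B \<longrightarrow>
        (\<forall>\<omega>\<in>space M. finite (\<Phi> \<omega> \<inter> B)) \<and>
        (\<lambda>\<omega>. card (\<Phi> \<omega> \<inter> B)) \<in> M \<rightarrow>\<^sub>M count_space UNIV)"

definition poisson_process :: "'w measure \<Rightarrow> nat \<Rightarrow> real \<Rightarrow> ('w \<Rightarrow> pt set) \<Rightarrow> bool" where
  "poisson_process M n lam \<Phi> \<longleftrightarrow>
     simple_point_process M n \<Phi> \<and>
     (\<forall>B k. bounded_borel n B \<longrightarrow>
        measure M {\<omega>\<in>space M. card (\<Phi> \<omega> \<inter> B) = k} =
          (lam * measure (euc n) B) ^ k / fact k * exp (- (lam * measure (euc n) B))) \<and>
     (\<forall>(m::nat) B. (\<forall>i<m. bounded_borel n (B i)) \<and> disjoint_family_on B {..<m} \<longrightarrow>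
        prob_space.indep_vars M (\<lambda>_. count_space UNIV) (\<lambda>i \<omega>. card (\<Phi> \<omega> \<inter> B i)) {..<m})"

definition matern :: "nat \<Rightarrow> real \<Rightarrow> pt set \<Rightarrow> pt set" where
  "matern n r S = {t\<in>S. \<not> (\<exists>s\<in>S. s \<noteq> t \<and> norm1 n (vdiff n s t) < r)}"

text \<open>
  \<open>T\<close> is a measurable enumeration, almost surely without repetition, of the random point set
  \<open>\<Psi>\<close>. Enumerating by all natural numbers is no restriction for the stationary processes considered
  here: in positive dimension they almost surely have infinitely many points.
\<close>

definition enumeration ::
    "'w measure \<Rightarrow> nat \<Rightarrow> (nat \<Rightarrow> 'w \<Rightarrow> pt) \<Rightarrow> ('w \<Rightarrow> pt set) \<Rightarrow> bool" where
  "enumeration M n T \<Psi> \<longleftrightarrow>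
     (\<forall>k. T k \<in> M \<rightarrow>\<^sub>M euc n) \<and>
     (AE \<omega> in M. inj (\<lambda>k. T k \<omega>) \<and> range (\<lambda>k. T k \<omega>) = \<Psi> \<omega>)"

text \<open>The marks \<open>D k\<close> are i.i.d. with law \<open>Q\<close> and independent of the point process.\<close>

definition iid_marks ::
    "'w measure \<Rightarrow> nat \<Rightarrow> (nat \<Rightarrow> 'w \<Rightarrow> pt) \<Rightarrow> (nat \<Rightarrow> 'w \<Rightarrow> pt) \<Rightarrow> pt measure \<Rightarrow> bool" where
  "iid_marks M n T D Q \<longleftrightarrow>
     prob_space.indep_vars M (\<lambda>_. euc n) D UNIV \<and>
     (\<forall>k. distr M (euc n) (D k) = Q) \<and>
     prob_space.indep_var M
       (\<Pi>\<^sub>M k\<in>UNIV. euc n) (\<lambda>\<omega> k. T k \<omega>)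
       (\<Pi>\<^sub>M k\<in>UNIV. euc n) (\<lambda>\<omega> k. D k \<omega>)"

definition sym_exp_density :: "real \<Rightarrow> real \<Rightarrow> real" where
  "sym_exp_density \<sigma> x = sqrt 2 / (2 * \<sigma>) * exp (- (sqrt 2 * \<bar>x\<bar> / \<sigma>))"

definition sym_exp_noise :: "nat \<Rightarrow> real \<Rightarrow> pt measure" where
  "sym_exp_noise n \<sigma> = (\<Pi>\<^sub>M i\<in>{..<n}. density lborel (\<lambda>x. ennreal (sym_exp_density \<sigma> x)))"

definition strictly_closest :: "nat \<Rightarrow> pt set \<Rightarrow> pt \<Rightarrow> pt \<Rightarrow> bool" where
  "strictly_closest n S t x \<longleftrightarrow>
     ereal (norm1 n (vdiff n x t)) < (INF s\<in>S - {t}. ereal (norm1 n (vdiff n x s)))"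

definition voronoi_cell :: "nat \<Rightarrow> pt set \<Rightarrow> pt \<Rightarrow> pt set" where
  "voronoi_cell n S t =
     {x\<in>space (euc n). \<forall>s\<in>S. norm2 n (vdiff n x t) \<le> norm2 n (vdiff n x s)}"

definition decoding_region :: "nat \<Rightarrow> pt set \<Rightarrow> pt \<Rightarrow> pt set" where
  "decoding_region n S t =
     {x\<in>space (euc n). strictly_closest n S t x \<or>
        ((\<forall>s\<in>S. \<not> strictly_closest n S s x) \<and> x \<in> voronoi_cell n S t)}"

definition unit_cube :: "nat \<Rightarrow> pt set" where
  "unit_cube n = (\<Pi>\<^sub>E i\<in>{..<n}. {0..<1})"

definition intensity :: "'w measure \<Rightarrow> nat \<Rightarrow> (nat \<Rightarrow> 'w \<Rightarrow> pt) \<Rightarrow> ennreal" where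
  "intensity M n T = (\<integral>\<^sup>+\<omega>. (\<Sum>k. indicator (unit_cube n) (T k \<omega>)) \<partial>M)"

definition shift_marked :: "nat \<Rightarrow> pt \<Rightarrow> (pt \<times> pt) set \<Rightarrow> (pt \<times> pt) set" where
  "shift_marked n a \<Gamma> = (\<lambda>(t, d). (vdiff n t a, d)) ` \<Gamma>"

text \<open>
  Palm probability (Matthes' definition) of the stationary marked point process with points \<open>T k\<close>
  and marks \<open>D k\<close>: the expected number of points in the unit cube from which the marked
  configuration, recentred at that point, lies in \<open>A\<close>, divided by the intensity.
\<close>

definition palm_prob ::
    "'w measure \<Rightarrow> nat \<Rightarrow> (nat \<Rightarrow> 'w \<Rightarrow> pt) \<Rightarrow> (nat \<Rightarrow> 'w \<Rightarrow> pt) \<Rightarrow> (pt \<times> pt) set set \<Rightarrow> ennreal" where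
  "palm_prob M n T D A =
     (\<integral>\<^sup>+\<omega>. (\<Sum>k. indicator {k. T k \<omega> \<in> unit_cube n \<and>
        shift_marked n (T k \<omega>) (range (\<lambda>l. (T l \<omega>, D l \<omega>))) \<in> A} k) \<partial>M) / intensity M n T"

text \<open>The displacement of the point at the origin leaves the decoding region of the origin.\<close>

definition decoding_error :: "nat \<Rightarrow> (pt \<times> pt) set set" where
  "decoding_error n =
     {\<Gamma>. \<exists>d. (origin n, d) \<in> \<Gamma> \<and> d \<notin> decoding_region n (fst ` \<Gamma>) (origin n)}"

definition error_prob :: "'w measure \<Rightarrow> nat \<Rightarrow> (nat \<Rightarrow> 'w \<Rightarrow> pt) \<Rightarrow> (nat \<Rightarrow> 'w \<Rightarrow> pt) \<Rightarrow> ennreal" where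
  "error_prob M n T D = palm_prob M n T D (decoding_error n)"

text \<open>\<open>- ln\<close> with its limiting values; note that \<open>ln 0 = 0\<close> on type \<open>real\<close>.\<close>

definition neg_ln :: "ennreal \<Rightarrow> ereal" where
  "neg_ln p = (if p = 0 then \<infinity> else if p = \<infinity> then - \<infinity> else ereal (- ln (enn2real p)))"

definition error_exponent :: "(nat \<Rightarrow> ennreal) \<Rightarrow> ereal" where
  "error_exponent p = liminf (\<lambda>n. neg_ln (p n) / ereal (real n))"

text \<open>
  A pitfall about the parameter \<open>\<epsilon>\<close> in an exclusion radius \<open>n * \<sigma> / sqrt 2 * (\<alpha> - \<epsilon>)\<close>. When
  \<open>\<alpha> > 4\<close>, an error exponent of at least \<open>\<alpha> / 2 - ln \<alpha> - 1 + 2 * ln 2\<close> requires \<open>\<epsilon>\<close> to be small: if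
  \<open>\<alpha> - \<epsilon> < 3\<close>, the points that cause typical errors lie outside the exclusion ball, so the exponent
  is that of the Poisson process, \<open>ln \<alpha> + 1 - 2 * ln 2\<close>, which is smaller. \<open>\<epsilon> \<le> 1\<close> is small enough.
  When \<open>\<alpha> \<le> 4\<close>, every \<open>\<epsilon> < \<alpha>\<close> is.
\<close>

end

theory Submission
  imports Defs
begin

text \<open>
  A decoding error at the origin with displacement \<open>d\<close> requires a competitor \<open>y\<close> with
  \<open>|d - y| \<le> |d|\<close> and \<open>|y| \<ge> r\<close>. By the second factorial moment measure of the Poisson process, the
  expected number of competitors is at most \<open>lam\<close> times the volume of that set, up to the factor
  \<open>lam\<close> over the Matern intensity, which tends to 1 since \<open>lam\<close> times the volume of the exclusion ball
  is at most \<open>((\<alpha> - \<epsilon>) / \<alpha>) ^ n\<close>. Replacing all indicators by exponentials of L1 norms turns the bounds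
  into n-th powers of two-dimensional integrals, and the three cases of the theorem come
  from three choices of the multipliers. In units where the noise has scale 1 and lengths are
  divided by \<open>n\<close>, the exclusion constraint \<open>|y| \<ge> \<alpha> - \<epsilon>\<close> only gets a positive multiplier,
  \<open>1 / 2 - 2 / \<alpha>\<close>, when \<open>\<alpha> > 4\<close>.
\<close>

section \<open>Exponential integrals\<close>

text \<open>The obstacle is measurability. The Poisson points come without a measurable enumeration:
  only their counts in bounded Borel sets are known to be random variables. Sums over pairs of
  points are therefore compared with sums over pairs of grid cells, where independence and the
  moments of Poisson counts suffice. This is affordable because the summands are products over
  coordinates of functions with Lipschitz logarithm, a second reason for trading indicators for
  exponentials: an indicator cannot absorb a rounding error at the price of a constant factor. The
  marks belong to the enumerated Matern points, not to \<open>\<Phi>\<close>. So the mark is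
  integrated out while the sum still runs over Matern pairs; the function of
  \<open>T l - T k\<close> that remains is then summed over the larger set of Poisson pairs. The
  same pair estimate serves twice: for competitors in a decoding error, and for deleted points,
  which bounds the intensity from below. With \<open>\<beta> = sqrt 2 / \<sigma>\<close> one has
  \<open>lam n = (\<beta> / (2 * exp 1 * \<alpha>)) ^ n\<close>, so every exponent results from
  choosing multipliers in a one-coordinate integral.\<close>

lemma nn_integral_abs:
  fixes f :: "real \<Rightarrow> ennreal"
  assumes [measurable]: "f \<in> borel_measurable borel"
  shows "(\<integral>\<^sup>+x. f \<bar>x\<bar> \<partial>lborel) = 2 * (\<integral>\<^sup>+x. f x * indicator {0..} x \<partial>lborel)"
proof -
  have "(\<integral>\<^sup>+x. f \<bar>x\<bar> \<partial>lborel) = (\<integral>\<^sup>+x. f x * indicator {0..} x + f (- x) * indicator {0..} (- x) \<partial>lborel)"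
    by (intro nn_integral_cong_AE, use AE_lborel_singleton[of "0::real"] in eventually_elim)
       (auto simp: indicator_def)
  also have "\<dots> = (\<integral>\<^sup>+x. f x * indicator {0..} x \<partial>lborel) + (\<integral>\<^sup>+x. f (- x) * indicator {0..} (- x) \<partial>lborel)"
    by (intro nn_integral_add) auto
  also have "(\<integral>\<^sup>+x. f (- x) * indicator {0..} (- x) \<partial>lborel) = (\<integral>\<^sup>+x. f x * indicator {0..} x \<partial>lborel)"
    by (subst nn_integral_real_affine[where c="-1" and t=0 and f="\<lambda>x. f x * indicator {0..} x"]) auto
  finally show ?thesis by (simp add: mult_2)
qed

lemma nn_integral_exp_half_line:
  assumes "p > (0::real)"
  shows "(\<integral>\<^sup>+x. ennreal (exp (- (p * x))) * indicator {0..} x \<partial>lborel) = ennreal (1 / p)"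
proof -
  have "(\<integral>\<^sup>+x. ennreal (exp (- (p * x))) * indicator {0..} x \<partial>lborel) = ennreal (0 - (- exp (- (p * 0)) / p))"
  proof (rule nn_integral_FTC_atLeast)
    show "((\<lambda>x. - exp (- (p * x)) / p) \<longlongrightarrow> 0) at_top" using assms by real_asymp
    show "\<And>x. DERIV (\<lambda>x. - exp (- (p * x)) / p) x :> exp (- (p * x))"
      using assms by (auto intro!: derivative_eq_intros)
  qed auto
  then show ?thesis by simp
qed

lemma nn_integral_exp_abs:
  assumes "p > (0::real)"
  shows "(\<integral>\<^sup>+x. ennreal (exp (- (p * \<bar>x\<bar>))) \<partial>lborel) = ennreal (2 / p)"
  using assms nn_integral_abs[of "\<lambda>x. ennreal (exp (- (p * x)))"]
  by (simp add: nn_integral_exp_half_line ennreal_mult''[symmetric] flip: ennreal_numeral)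

lemma nn_integral_abs_exp_abs:
  assumes "p > (0::real)" "c \<ge> 0"
  shows "(\<integral>\<^sup>+x. ennreal ((\<bar>x\<bar> + c) * exp (- (p * \<bar>x\<bar>))) \<partial>lborel) = ennreal (2 / p\<^sup>2 + 2 * c / p)"
proof -
  let ?F = "\<lambda>x. - ((x + c) / p + 1 / p\<^sup>2) * exp (- (p * x))"
  have "(\<integral>\<^sup>+x. ennreal ((x + c) * exp (- (p * x))) * indicator {0..} x \<partial>lborel) = ennreal (0 - ?F 0)"
  proof (rule nn_integral_FTC_atLeast)
    show "(?F \<longlongrightarrow> 0) at_top" using assms by real_asymp
    show "\<And>x. DERIV ?F x :> (x + c) * exp (- (p * x))"
      using assms by (auto intro!: derivative_eq_intros simp: field_simps power2_eq_square)
  qed (use assms in auto)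
  then show ?thesis
    using assms nn_integral_abs[of "\<lambda>x. ennreal ((x + c) * exp (- (p * x)))"]
    by (simp add: ennreal_mult''[symmetric] algebra_simps flip: ennreal_numeral)
qed

text \<open>Outside the segment between \<open>0\<close> and \<open>y\<close>, the sum
  \<open>|x| + |y - x|\<close> exceeds \<open>|y|\<close> by twice the distance to the segment. So
  the segment contributes its length and each of the two tails \<open>1 / \<beta>\<close>, all with
  the common factor \<open>exp (- (\<beta> * |y| / 2))\<close>.\<close>

lemma nn_integral_exp_dist_le:
  assumes "\<beta> > (0::real)"
  shows "(\<integral>\<^sup>+x. ennreal (exp (- (\<beta> * (\<bar>x\<bar> + \<bar>y - x\<bar>) / 2))) \<partial>lborel)
           \<le> ennreal ((\<bar>y\<bar> + 2 / \<beta>) * exp (- (\<beta> * \<bar>y\<bar> / 2)))"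
proof -
  define m M where "m = min 0 y" and "M = max 0 y"
  have yM: "\<bar>y\<bar> = M - m" "m \<le> M" by (auto simp: m_def M_def)
  let ?E = "exp (- (\<beta> * \<bar>y\<bar> / 2))"
  let ?r = "\<lambda>x. ennreal (exp (- (\<beta> * x))) * indicator {0..} x"
  have pt: "ennreal (exp (- (\<beta> * (\<bar>x\<bar> + \<bar>y - x\<bar>) / 2)))
     \<le> ennreal ?E * (indicator {m..M} x + (?r (m - x) + ?r (x - M)))" for x
  proof -
    consider "x < m" | "m \<le> x" "x \<le> M" | "M < x" by linarith
    then show ?thesis
    proof cases
      case 1
      then have "\<beta> * (\<bar>x\<bar> + \<bar>y - x\<bar>) / 2 = \<beta> * \<bar>y\<bar> / 2 + \<beta> * (m - x)"
        by (auto simp: m_def field_simps)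
      then have "ennreal (exp (- (\<beta> * (\<bar>x\<bar> + \<bar>y - x\<bar>) / 2))) = ennreal ?E * ?r (m - x)"
        using 1 by (simp only: minus_add_distrib exp_add) (simp add: ennreal_mult'')
      also have "\<dots> \<le> ennreal ?E * (indicator {m..M} x + (?r (m - x) + ?r (x - M)))"
        by (intro mult_left_mono) (auto simp: add_increasing)
      finally show ?thesis .
    next
      case 2
      then have "\<bar>x\<bar> + \<bar>y - x\<bar> = \<bar>y\<bar>"
        by (auto simp: m_def M_def min_def max_def split: if_splits)
      with 2 show ?thesis by (simp add: distrib_left)
    next
      case 3
      then have "\<beta> * (\<bar>x\<bar> + \<bar>y - x\<bar>) / 2 = \<beta> * \<bar>y\<bar> / 2 + \<beta> * (x - M)"
        by (auto simp: M_def field_simps)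
      then have "ennreal (exp (- (\<beta> * (\<bar>x\<bar> + \<bar>y - x\<bar>) / 2))) = ennreal ?E * ?r (x - M)"
        using 3 by (simp only: minus_add_distrib exp_add) (simp add: ennreal_mult'')
      also have "\<dots> \<le> ennreal ?E * (indicator {m..M} x + (?r (m - x) + ?r (x - M)))"
        by (intro mult_left_mono) (auto simp: add_increasing)
      finally show ?thesis .
    qed
  qed
  have r1: "(\<integral>\<^sup>+x. ?r (m - x) \<partial>lborel) = ennreal (1 / \<beta>)"
    using assms nn_integral_real_affine[where c="-1" and t=m and f="?r"] nn_integral_exp_half_line[OF assms]
    by simp
  have r2: "(\<integral>\<^sup>+x. ?r (x - M) \<partial>lborel) = ennreal (1 / \<beta>)"
    using assms nn_integral_real_affine[where c="1" and t="-M" and f="?r"] nn_integral_exp_half_line[OF assms]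
    by simp
  have "(\<integral>\<^sup>+x. ennreal (exp (- (\<beta> * (\<bar>x\<bar> + \<bar>y - x\<bar>) / 2))) \<partial>lborel)
    \<le> (\<integral>\<^sup>+x. ennreal ?E * (indicator {m..M} x + (?r (m - x) + ?r (x - M))) \<partial>lborel)"
    by (intro nn_integral_mono pt)
  also have "\<dots> = ennreal ?E * ((\<integral>\<^sup>+x. indicator {m..M} x \<partial>lborel) + ((\<integral>\<^sup>+x. ?r (m - x) \<partial>lborel) + (\<integral>\<^sup>+x. ?r (x - M) \<partial>lborel)))"
    by (subst nn_integral_cmult, simp, subst nn_integral_add, simp, simp, subst nn_integral_add) auto
  also have "\<dots> = ennreal ?E * (ennreal (M - m) + (ennreal (1 / \<beta>) + ennreal (1 / \<beta>)))"
    unfolding r1 r2 using yM(2) by simp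
  also have "\<dots> = ennreal ((\<bar>y\<bar> + 2 / \<beta>) * exp (- (\<beta> * \<bar>y\<bar> / 2)))"
    using yM assms by (simp add: ennreal_mult'[symmetric] mult.commute flip: ennreal_plus)
  finally show ?thesis .
qed

section \<open>Factorial moments of Poisson counts\<close>

lemma poisson_first_moment_sums:
  "(\<lambda>k. real k * (m ^ k / fact k * exp (- m))) sums (m::real)"
proof -
  have "(\<lambda>k. m * (m ^ k / fact k * exp (- m))) sums (m * (exp m * exp (- m)))"
    using exp_converges[of m] by (intro sums_mult sums_mult2) (simp add: scaleR_conv_of_real divide_inverse mult.commute)
  then have "(\<lambda>k. m * (m ^ k / fact k * exp (- m))) sums m"
    by (simp only: exp_minus_inverse mult_1_right)
  moreover have "m * (m ^ k / fact k * exp (- m)) = real (Suc k) * (m ^ Suc k / fact (Suc k) * exp (- m))" for k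
    by (simp add: divide_simps del: of_nat_Suc)
  ultimately have "(\<lambda>k. real (Suc k) * (m ^ Suc k / fact (Suc k) * exp (- m))) sums m"
    by (simp only:)
  from sums_Suc[OF this] show ?thesis by simp
qed

text \<open>The Poisson weights satisfy \<open>m * p k = Suc k * p (Suc k)\<close>, so this series
  is \<open>m\<close> times the first moment series with the index shifted. Truncated subtraction is
  harmless at \<open>k = 0\<close>, where the factor \<open>k\<close> vanishes.\<close>

lemma poisson_second_factorial_moment_sums:
  "(\<lambda>k. real (k * (k - 1)) * (m ^ k / fact k * exp (- m))) sums (m\<^sup>2 :: real)"
proof -
  have "(\<lambda>k. m * (real k * (m ^ k / fact k * exp (- m)))) sums (m * m)"
    by (intro sums_mult poisson_first_moment_sums)
  moreover have "m * (real k * (m ^ k / fact k * exp (- m))) =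
      real (Suc k * (Suc k - 1)) * (m ^ Suc k / fact (Suc k) * exp (- m))" for k
    by (simp add: divide_simps) (simp add: algebra_simps)
  ultimately have "(\<lambda>k. real (Suc k * (Suc k - 1)) * (m ^ Suc k / fact (Suc k) * exp (- m))) sums (m * m)"
    by simp
  from sums_Suc[OF this] show ?thesis by (simp add: power2_eq_square)
qed

section \<open>Rounding to a grid of mesh 1/n\<close>

lemma euc_component_measurable [measurable]:
  "i < n \<Longrightarrow> (\<lambda>x. x i) \<in> borel_measurable (euc n)"
  unfolding euc_def by measurable

lemma space_euc: "space (euc n) = ({..<n} \<rightarrow>\<^sub>E UNIV)"
  by (simp add: euc_def space_PiM)

interpretation lborel_product: product_sigma_finite "\<lambda>_::nat. lborel :: real measure"
  by standard

lemma nn_integral_euc_prod: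
  assumes "\<And>i. i < n \<Longrightarrow> f i \<in> borel_measurable borel"
  shows "(\<integral>\<^sup>+x. (\<Prod>i<n. f i (x i)) \<partial>euc n) = (\<Prod>i<n. \<integral>\<^sup>+x. f i x \<partial>lborel)"
  unfolding euc_def using assms by (intro lborel_product.product_nn_integral_prod) auto

lemma unit_cube_sets [measurable]: "unit_cube n \<in> sets (euc n)"
  unfolding unit_cube_def euc_def by (intro sets_PiM_I_finite) auto

lemma emeasure_unit_cube: "emeasure (euc n) (unit_cube n) = 1"
  unfolding unit_cube_def euc_def by (subst lborel_product.emeasure_PiM) auto

lemma bounded_borel_unit_cube: "bounded_borel n (unit_cube n)"
  unfolding bounded_borel_def
proof (intro conjI exI ballI)
  fix x assume "x \<in> unit_cube n"
  then show "norm1 n x \<le> real n"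
    unfolding norm1_def using sum_bounded_above[of "{..<n}" "\<lambda>i. \<bar>x i\<bar>" 1]
    by (auto simp: unit_cube_def PiE_iff less_imp_le)
qed auto

definition grid_round :: "nat \<Rightarrow> pt \<Rightarrow> pt" where
  "grid_round n x = (\<lambda>i\<in>{..<n}. of_int \<lfloor>real n * x i\<rfloor> / real n)"

definition grid :: "nat \<Rightarrow> pt set" where
  "grid n = ({..<n} \<rightarrow>\<^sub>E range (\<lambda>j::int. of_int j / real n))"

definition cell :: "nat \<Rightarrow> pt \<Rightarrow> pt set" where
  "cell n q = {x \<in> space (euc n). grid_round n x = q}"

lemma countable_grid [simp]: "countable (grid n)"
  unfolding grid_def by (intro countable_PiE) auto

lemma grid_round_in_grid [simp]: "grid_round n x \<in> grid n"
  by (auto simp: grid_round_def grid_def)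

lemma grid_round_close:
  assumes "i < n"
  shows "0 \<le> x i - grid_round n x i" "x i - grid_round n x i < 1 / real n"
proof -
  have n: "real n > 0" using assms by simp
  have "of_int \<lfloor>real n * x i\<rfloor> \<le> real n * x i" by simp
  then show "0 \<le> x i - grid_round n x i"
    using assms n by (simp add: grid_round_def field_simps)
  have "real n * x i < of_int \<lfloor>real n * x i\<rfloor> + 1" by linarith
  then have "(real n * x i - of_int \<lfloor>real n * x i\<rfloor>) / real n < 1 / real n"
    using n by (intro divide_strict_right_mono) linarith+
  then show "x i - grid_round n x i < 1 / real n"
    using assms n by (simp add: grid_round_def diff_divide_distrib)
qed

text \<open>The mesh divides 1, so the half-open cube is a union of whole cells and rounding causes
  no boundary effect in the Palm sums over the cube.\<close>

lemma grid_round_unit_cube_iff: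
  assumes "x \<in> space (euc n)"
  shows "grid_round n x \<in> unit_cube n \<longleftrightarrow> x \<in> unit_cube n"
proof -
  have "grid_round n x i \<in> {0..<1} \<longleftrightarrow> x i \<in> {0..<1}" if "i < n" for i
  proof -
    have n: "real n > 0" using that by simp
    have "of_int \<lfloor>real n * x i\<rfloor> < real n \<longleftrightarrow> real n * x i < real n"
      using floor_less_iff[of "real n * x i" "int n"]
        of_int_less_iff[of "\<lfloor>real n * x i\<rfloor>" "int n", where 'a=real] by simp
    then show ?thesis
      using that n by (auto simp: grid_round_def divide_simps zero_le_mult_iff)
  qed
  moreover have "grid_round n x \<in> extensional {..<n}" "x \<in> extensional {..<n}"
    using assms by (auto simp: grid_round_def space_euc PiE_iff)
  ultimately show ?thesis by (auto simp: unit_cube_def PiE_iff)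
qed

lemma cell_sets [measurable]: 
  assumes "q \<in> grid n" shows "cell n q \<in> sets (euc n)"
proof -
  have "cell n q = {x \<in> space (euc n). \<forall>i\<in>{..<n}. of_int \<lfloor>real n * x i\<rfloor> / real n = q i}"
    using assms by (auto simp: cell_def grid_round_def grid_def PiE_iff extensional_def fun_eq_iff)
  also have "\<dots> \<in> sets (euc n)" by measurable
  finally show ?thesis .
qed

lemma bounded_borel_cell:
  assumes "q \<in> grid n" shows "bounded_borel n (cell n q)"
  unfolding bounded_borel_def
proof (intro conjI exI ballI)
  show "cell n q \<in> sets (euc n)" using assms by (rule cell_sets)
  fix x assume x: "x \<in> cell n q"
  have "\<bar>x i\<bar> \<le> \<bar>q i\<bar> + 1" if "i < n" for i
  proof -
    have "1 / real n \<le> 1" using that by simp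
    then show ?thesis
      using grid_round_close[OF that, of x] x by (auto simp: cell_def)
  qed
  then show "norm1 n x \<le> (\<Sum>i<n. \<bar>q i\<bar> + 1)"
    unfolding norm1_def by (intro sum_mono) auto
qed

lemma nn_integral_count_space_point:
  assumes "a \<in> A"
  shows "(\<integral>\<^sup>+q. f q * indicator {a} q \<partial>count_space A) = (f a :: ennreal)"
  using assms by (subst nn_integral_indicator_singleton) auto

text \<open>Tonelli over the countable grid: each \<open>x\<close> lies in exactly one cell, the one
  labelled \<open>grid_round n x\<close>. This is the way back from grid sums to Lebesgue
  integrals.\<close>

lemma nn_integral_grid_cells:
  "(\<integral>\<^sup>+q. f q * emeasure (euc n) (cell n q) \<partial>count_space (grid n)) = (\<integral>\<^sup>+x. f (grid_round n x) \<partial>euc n)"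
proof -
  have "(\<integral>\<^sup>+q. f q * emeasure (euc n) (cell n q) \<partial>count_space (grid n))
      = (\<integral>\<^sup>+q. \<integral>\<^sup>+x. f q * indicator (cell n q) x \<partial>euc n \<partial>count_space (grid n))"
    by (intro nn_integral_cong) (simp add: nn_integral_cmult_indicator)
  also have "\<dots> = (\<integral>\<^sup>+x. \<integral>\<^sup>+q. f q * indicator (cell n q) x \<partial>count_space (grid n) \<partial>euc n)"
    by (intro nn_integral_count_space_nn_integral[symmetric]) auto
  also have "\<dots> = (\<integral>\<^sup>+x. f (grid_round n x) \<partial>euc n)"
  proof (intro nn_integral_cong)
    fix x assume "x \<in> space (euc n)"
    then have "(\<integral>\<^sup>+q. f q * indicator (cell n q) x \<partial>count_space (grid n))
      = (\<integral>\<^sup>+q. f q * indicator {grid_round n x} q \<partial>count_space (grid n))"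
      by (intro nn_integral_cong) (auto simp: indicator_def cell_def)
    then show "(\<integral>\<^sup>+q. f q * indicator (cell n q) x \<partial>count_space (grid n)) = f (grid_round n x)"
      by (simp add: nn_integral_count_space_point)
  qed
  finally show ?thesis .
qed

lemma sum_cells_unit_cube:
  "(\<integral>\<^sup>+q. emeasure (euc n) (cell n q) \<partial>count_space (grid n \<inter> unit_cube n)) = 1"
proof -
  have "(\<integral>\<^sup>+q. emeasure (euc n) (cell n q) \<partial>count_space (grid n \<inter> unit_cube n))
     = (\<integral>\<^sup>+q. indicator (unit_cube n) q * emeasure (euc n) (cell n q) \<partial>count_space (grid n))"
    by (subst (1 2) nn_integral_count_space_indicator)
       (auto intro!: nn_integral_cong simp: indicator_def)
  also have "\<dots> = (\<integral>\<^sup>+x. indicator (unit_cube n) (grid_round n x) \<partial>euc n)"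
    by (rule nn_integral_grid_cells)
  also have "\<dots> = (\<integral>\<^sup>+x. indicator (unit_cube n) x \<partial>euc n)"
    by (intro nn_integral_cong) (simp add: indicator_def grid_round_unit_cube_iff)
  finally show ?thesis by (simp add: emeasure_unit_cube)
qed

section \<open>Counts of a Poisson process\<close>

locale poisson_points = prob_space M for M :: "'w measure" +
  fixes n :: nat and lam :: real and \<Phi> :: "'w \<Rightarrow> pt set"
  assumes n_pos: "n > 0" and lam_nonneg: "lam \<ge> 0" and poisson: "poisson_process M n lam \<Phi>"
begin

lemma points_in_space: "\<omega> \<in> space M \<Longrightarrow> \<Phi> \<omega> \<subseteq> space (euc n)"
  using poisson by (simp add: poisson_process_def simple_point_process_def)

lemma finite_points: "bounded_borel n B \<Longrightarrow> \<omega> \<in> space M \<Longrightarrow> finite (\<Phi> \<omega> \<inter> B)"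
  using poisson by (simp add: poisson_process_def simple_point_process_def)

lemma count_measurable [measurable (raw)]:
  "bounded_borel n B \<Longrightarrow> (\<lambda>\<omega>. card (\<Phi> \<omega> \<inter> B)) \<in> M \<rightarrow>\<^sub>M count_space UNIV"
  using poisson by (simp add: poisson_process_def simple_point_process_def)

lemma nn_integral_count:
  fixes f :: "nat \<Rightarrow> real"
  assumes B: "bounded_borel n B" and f: "\<And>k. f k \<ge> 0"
    and sums: "(\<lambda>k. f k * ((lam * measure (euc n) B) ^ k / fact k * exp (- (lam * measure (euc n) B)))) sums s"
  shows "(\<integral>\<^sup>+\<omega>. ennreal (f (card (\<Phi> \<omega> \<inter> B))) \<partial>M) = ennreal s"
proof -
  note [measurable] = count_measurable[OF B]
  let ?N = "\<lambda>\<omega>. card (\<Phi> \<omega> \<inter> B)" and ?E = "\<lambda>k. {\<omega> \<in> space M. card (\<Phi> \<omega> \<inter> B) = k}"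
  have "(\<integral>\<^sup>+\<omega>. ennreal (f (?N \<omega>)) \<partial>M) = (\<integral>\<^sup>+\<omega>. (\<Sum>k. ennreal (f k) * indicator (?E k) \<omega>) \<partial>M)"
  proof (intro nn_integral_cong)
    fix \<omega> assume \<omega>: "\<omega> \<in> space M"
    have "(\<Sum>k. ennreal (f k) * indicator (?E k) \<omega>) = (\<Sum>k\<in>{?N \<omega>}. ennreal (f k) * indicator (?E k) \<omega>)"
      by (intro suminf_finite) auto
    then show "ennreal (f (?N \<omega>)) = (\<Sum>k. ennreal (f k) * indicator (?E k) \<omega>)"
      using \<omega> by simp
  qed
  also have "\<dots> = (\<Sum>k. ennreal (f k) * emeasure M (?E k))"
    by (subst nn_integral_suminf) (simp_all add: nn_integral_cmult)
  also have "\<dots> = (\<Sum>k. ennreal (f k * measure M (?E k)))"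
    by (simp add: emeasure_eq_measure ennreal_mult f)
  also have "\<dots> = ennreal s"
  proof -
    have "measure M (?E k) = (lam * measure (euc n) B) ^ k / fact k * exp (- (lam * measure (euc n) B))" for k
      using poisson B by (simp add: poisson_process_def)
    with sums have "(\<lambda>k. f k * measure M (?E k)) sums s" by simp
    then show ?thesis using f by (intro suminf_ennreal_eq) auto
  qed
  finally show ?thesis .
qed

lemma expectation_count:
  "bounded_borel n B \<Longrightarrow> (\<integral>\<^sup>+\<omega>. of_nat (card (\<Phi> \<omega> \<inter> B)) \<partial>M) = ennreal (lam * measure (euc n) B)"
  using nn_integral_count[of B real] poisson_first_moment_sums
  by (simp add: ennreal_of_nat_eq_real_of_nat)

text \<open>Ordered pairs off the diagonal, so that the expected cardinality is a second factorial
  moment, which for a Poisson process is a product even when \<open>A = B\<close>.\<close>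

definition pairs :: "'w \<Rightarrow> pt set \<Rightarrow> pt set \<Rightarrow> (pt \<times> pt) set" where
  "pairs \<omega> A B = {(x, y). x \<in> \<Phi> \<omega> \<inter> A \<and> y \<in> \<Phi> \<omega> \<inter> B \<and> x \<noteq> y}"

lemma card_pairs_same:
  assumes "bounded_borel n A" "\<omega> \<in> space M"
  shows "card (pairs \<omega> A A) = card (\<Phi> \<omega> \<inter> A) * (card (\<Phi> \<omega> \<inter> A) - 1)"
proof -
  have "pairs \<omega> A A = Sigma (\<Phi> \<omega> \<inter> A) (\<lambda>x. \<Phi> \<omega> \<inter> A - {x})"
    by (auto simp: pairs_def)
  then show ?thesis using finite_points[OF assms] by (simp add: card_SigmaI)
qed

lemma card_pairs_disjoint:
  assumes "A \<inter> B = {}"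
  shows "card (pairs \<omega> A B) = card (\<Phi> \<omega> \<inter> A) * card (\<Phi> \<omega> \<inter> B)"
proof -
  have "pairs \<omega> A B = (\<Phi> \<omega> \<inter> A) \<times> (\<Phi> \<omega> \<inter> B)"
    using assms by (auto simp: pairs_def)
  then show ?thesis by (simp add: card_cartesian_product)
qed

lemma card_pairs_measurable:
  assumes "bounded_borel n A" "bounded_borel n B" "A \<inter> B = {} \<or> A = B"
  shows "(\<lambda>\<omega>. of_nat (card (pairs \<omega> A B)) :: ennreal) \<in> borel_measurable M"
  using assms(3)
proof
  assume "A \<inter> B = {}"
  note [measurable] = count_measurable[OF assms(1)] count_measurable[OF assms(2)]
  show ?thesis using card_pairs_disjoint[OF \<open>A \<inter> B = {}\<close>] by simp
next
  assume [simp]: "A = B"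
  note [measurable] = count_measurable[OF assms(1)]
  have "(\<lambda>\<omega>. of_nat (card (\<Phi> \<omega> \<inter> A) * (card (\<Phi> \<omega> \<inter> A) - 1)) :: ennreal) \<in> borel_measurable M"
    by measurable
  then show ?thesis
    using assms(1) by (subst measurable_cong[where g="\<lambda>\<omega>. of_nat (card (\<Phi> \<omega> \<inter> A) * (card (\<Phi> \<omega> \<inter> A) - 1))"])
       (simp_all add: card_pairs_same del: of_nat_mult)
qed

text \<open>Disjoint sets are settled by independence of the counts, equal sets by the factorial
  moment \<open>k * (k - 1)\<close>. Two grid cells always fall under one of these cases.\<close>

lemma expectation_pairs:
  assumes A: "bounded_borel n A" and B: "bounded_borel n B" and AB: "A \<inter> B = {} \<or> A = B"
  shows "(\<integral>\<^sup>+\<omega>. of_nat (card (pairs \<omega> A B)) \<partial>M)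
    = ennreal (lam * measure (euc n) A) * ennreal (lam * measure (euc n) B)"
  using AB
proof
  assume dis: "A \<inter> B = {}"
  define C where "C = (\<lambda>i::nat. if i = 0 then A else B)"
  have "indep_vars (\<lambda>_. count_space UNIV) (\<lambda>i \<omega>. card (\<Phi> \<omega> \<inter> C i)) {..<2}"
    using poisson dis A B unfolding poisson_process_def
    by (elim conjE allE[where x=2] allE[where x=C] impE)
       (auto simp: C_def disjoint_family_on_def)
  then have "indep_vars (\<lambda>_. borel) (\<lambda>i \<omega>. of_nat (card (\<Phi> \<omega> \<inter> C i)) :: ennreal) {..<2}"
    by (rule indep_vars_compose2[where Y="\<lambda>_. of_nat"]) auto
  from indep_vars_nn_integral[OF _ this]
  have "(\<integral>\<^sup>+\<omega>. of_nat (card (\<Phi> \<omega> \<inter> A)) * of_nat (card (\<Phi> \<omega> \<inter> B)) \<partial>M)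
    = (\<integral>\<^sup>+\<omega>. of_nat (card (\<Phi> \<omega> \<inter> A)) \<partial>M) * (\<integral>\<^sup>+\<omega>. of_nat (card (\<Phi> \<omega> \<inter> B)) \<partial>M)"
    by (simp add: numeral_2_eq_2 lessThan_Suc C_def mult.commute)
  then show ?thesis
    using expectation_count[OF A] expectation_count[OF B] card_pairs_disjoint[OF dis] by simp
next
  assume [simp]: "A = B"
  have "(\<integral>\<^sup>+\<omega>. of_nat (card (pairs \<omega> A B)) \<partial>M)
     = (\<integral>\<^sup>+\<omega>. ennreal (real (card (\<Phi> \<omega> \<inter> A) * (card (\<Phi> \<omega> \<inter> A) - 1))) \<partial>M)"
    using card_pairs_same[OF A] by (intro nn_integral_cong) (simp add: ennreal_of_nat_eq_real_of_nat)
  also have "\<dots> = ennreal ((lam * measure (euc n) A)\<^sup>2)"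
    by (intro nn_integral_count[OF A, where f="\<lambda>k. real (k * (k - 1))"] poisson_second_factorial_moment_sums) auto
  finally show ?thesis
    using lam_nonneg by (simp add: power2_eq_square ennreal_mult)
qed

end

section \<open>Pair sums over a Poisson process\<close>

lemma borel_measurable_nn_integral_count_space:
  fixes f :: "'i \<Rightarrow> 'x \<Rightarrow> ennreal"
  assumes I: "countable I" and f: "\<And>i. i \<in> I \<Longrightarrow> f i \<in> borel_measurable N"
  shows "(\<lambda>x. \<integral>\<^sup>+i. f i x \<partial>count_space I) \<in> borel_measurable N"
proof -
  interpret sigma_finite_measure "count_space I"
    using I by (rule sigma_finite_measure_count_space_countable)
  have "(\<lambda>(i, x). f i x) \<in> borel_measurable (count_space I \<Otimes>\<^sub>M N)"
    using I f by (intro measurable_pair_measure_countable1) auto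
  then have "(\<lambda>(x, i). f i x) \<in> borel_measurable (N \<Otimes>\<^sub>M count_space I)"
    by (subst (asm) measurable_pair_swap_iff) (simp add: case_prod_unfold)
  then show ?thesis by (rule borel_measurable_nn_integral)
qed

lemma prod_le_power_mult:
  fixes f h :: "nat \<Rightarrow> ennreal"
  assumes "\<And>i. i < n \<Longrightarrow> f i \<le> C * h i"
  shows "(\<Prod>i<n. f i) \<le> C ^ n * (\<Prod>i<n. h i)"
  using assms
proof (induction n)
  case (Suc n)
  then have "(\<Prod>i<n. f i) * f n \<le> (C ^ n * (\<Prod>i<n. h i)) * (C * h n)"
    by (intro mult_mono) auto
  then show ?case by (simp add: mult_ac)
qed simp

lemma cell_subset_unit_cube: "q \<in> unit_cube n \<Longrightarrow> cell n q \<subseteq> unit_cube n"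
  by (auto simp: cell_def grid_round_unit_cube_iff)

lemma cells_disjoint_or_eq: "cell n q \<inter> cell n q' = {} \<or> cell n q = cell n q'"
  by (auto simp: cell_def)

context poisson_points
begin

text \<open>
  A measurable upper bound for a sum over pairs of distinct points of \<open>\<Phi>\<close>: the points themselves are
  not measurably enumerated, only the counts in Borel sets are measurable. The constant \<open>C\<close> pays for
  moving one difference of coordinates by at most \<open>1 / n\<close>; with \<open>C = exp (L / n)\<close> the total loss
  \<open>C ^ (2 * n)\<close> is bounded in \<open>n\<close>.
\<close>

definition pair_dominator :: "(real \<Rightarrow> ennreal) \<Rightarrow> ennreal \<Rightarrow> 'w \<Rightarrow> ennreal" where
  "pair_dominator g C \<omega> =
     (\<integral>\<^sup>+q. \<integral>\<^sup>+q'. C ^ n * (\<Prod>i<n. g (q' i - q i)) * of_nat (card (pairs \<omega> (cell n q) (cell n q')))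
        \<partial>count_space (grid n) \<partial>count_space (grid n \<inter> unit_cube n))"

lemma cell_pairs_measurable:
  assumes "q \<in> grid n" "q' \<in> grid n"
  shows "(\<lambda>\<omega>. of_nat (card (pairs \<omega> (cell n q) (cell n q'))) :: ennreal) \<in> borel_measurable M"
  using assms by (intro card_pairs_measurable bounded_borel_cell cells_disjoint_or_eq)

lemma pair_dominator_measurable [measurable]: "pair_dominator g C \<in> borel_measurable M"
  unfolding pair_dominator_def[abs_def]
  using cell_pairs_measurable by (intro borel_measurable_nn_integral_count_space) auto

text \<open>Each pair of points is charged to the pair of cells containing it, and the summand is
  evaluated at the cell labels instead, at the price of a factor \<open>C\<close> per coordinate.
  Exchanging the sums then leaves the number of pairs in each pair of cells.\<close>

lemma pairs_le_pair_dominator: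
  assumes g: "\<And>u v. \<bar>u - v\<bar> \<le> 1 / real n \<Longrightarrow> g u \<le> C * g v" and \<omega>: "\<omega> \<in> space M"
  shows "(\<integral>\<^sup>+z. (\<Prod>i<n. g (snd z i - fst z i)) \<partial>count_space (pairs \<omega> (unit_cube n) UNIV)) \<le> pair_dominator g C \<omega>"
proof -
  let ?P = "pairs \<omega> (unit_cube n) UNIV" and ?R = "grid n" and ?Q = "grid n \<inter> unit_cube n"
  let ?G = "\<lambda>q q'. C ^ n * (\<Prod>i<n. g (q' i - q i))"
  let ?i = "\<lambda>a b. indicator {grid_round n a} b :: ennreal"
  have "(\<integral>\<^sup>+z. (\<Prod>i<n. g (snd z i - fst z i)) \<partial>count_space ?P)
    \<le> (\<integral>\<^sup>+z. \<integral>\<^sup>+q. \<integral>\<^sup>+q'. ?G q q' * (?i (snd z) q' * ?i (fst z) q) \<partial>count_space ?R \<partial>count_space ?Q \<partial>count_space ?P)"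
  proof (intro nn_integral_mono)
    fix z assume "z \<in> space (count_space ?P)"
    then have z: "fst z \<in> \<Phi> \<omega>" "fst z \<in> unit_cube n"
      by (auto simp: pairs_def)
    then have "grid_round n (fst z) \<in> ?Q"
      using points_in_space[OF \<omega>] by (auto simp: grid_round_unit_cube_iff)
    moreover have "(\<integral>\<^sup>+q'. ?G q q' * (?i (snd z) q' * ?i (fst z) q) \<partial>count_space ?R)
      = ?G q (grid_round n (snd z)) * ?i (fst z) q" for q
      by (simp only: mult.assoc[symmetric])
         (simp only: nn_integral_multc borel_measurable_count_space nn_integral_count_space_point grid_round_in_grid)
    ultimately have "(\<integral>\<^sup>+q. \<integral>\<^sup>+q'. ?G q q' * (?i (snd z) q' * ?i (fst z) q) \<partial>count_space ?R \<partial>count_space ?Q)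
      = ?G (grid_round n (fst z)) (grid_round n (snd z))"
      by (simp only: nn_integral_count_space_point)
    \<comment> \<open>Both rounding errors lie in \<open>[0, 1 / n)\<close>, so their difference is
      at most \<open>1 / n\<close>, not \<open>2 / n\<close>.\<close>
    moreover have "\<bar>(snd z i - fst z i) - (grid_round n (snd z) i - grid_round n (fst z) i)\<bar> \<le> 1 / real n"
      if "i < n" for i
      using grid_round_close[OF that, of "fst z"] grid_round_close[OF that, of "snd z"] by linarith
    ultimately show "(\<Prod>i<n. g (snd z i - fst z i)) \<le> (\<integral>\<^sup>+q. \<integral>\<^sup>+q'. ?G q q' * (?i (snd z) q' * ?i (fst z) q) \<partial>count_space ?R \<partial>count_space ?Q)"
      using g by (auto intro: prod_le_power_mult)
  qed
  also have "\<dots> = (\<integral>\<^sup>+q. \<integral>\<^sup>+q'. \<integral>\<^sup>+z. ?G q q' * (?i (snd z) q' * ?i (fst z) q) \<partial>count_space ?P \<partial>count_space ?R \<partial>count_space ?Q)"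
    (is "?lhs = ?rhs")
  proof -
    have "?lhs = (\<integral>\<^sup>+q. \<integral>\<^sup>+z. \<integral>\<^sup>+q'. ?G q q' * (?i (snd z) q' * ?i (fst z) q) \<partial>count_space ?R \<partial>count_space ?P \<partial>count_space ?Q)"
      by (rule nn_integral_count_space_nn_integral) simp_all
    also have "\<dots> = ?rhs"
      by (intro nn_integral_cong nn_integral_count_space_nn_integral) simp_all
    finally show ?thesis .
  qed
  also have "\<dots> \<le> pair_dominator g C \<omega>"
    unfolding pair_dominator_def
  proof (intro nn_integral_mono)
    fix q q' assume "q \<in> space (count_space ?Q)" "q' \<in> space (count_space ?R)"
    then have q: "q \<in> ?R" "q \<in> unit_cube n" "q' \<in> ?R" by auto
    have sub: "pairs \<omega> (cell n q) (cell n q') \<subseteq> ?P"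
      using cell_subset_unit_cube[OF q(2)] by (auto simp: pairs_def)
    have "(\<integral>\<^sup>+z. ?i (snd z) q' * ?i (fst z) q \<partial>count_space ?P) = (\<integral>\<^sup>+z. indicator (pairs \<omega> (cell n q) (cell n q')) z \<partial>count_space ?P)"
    proof (intro nn_integral_cong)
      fix z assume "z \<in> space (count_space ?P)"
      then have "z \<in> pairs \<omega> (cell n q) (cell n q') \<longleftrightarrow> q' = grid_round n (snd z) \<and> q = grid_round n (fst z)"
        using points_in_space[OF \<omega>] by (cases z) (auto simp: pairs_def cell_def)
      then show "?i (snd z) q' * ?i (fst z) q = indicator (pairs \<omega> (cell n q) (cell n q')) z"
        by (simp add: indicator_def)
    qed
    also have "\<dots> = emeasure (count_space ?P) (pairs \<omega> (cell n q) (cell n q'))"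
      using sub by (intro nn_integral_indicator) auto
    also have "\<dots> = of_nat (card (pairs \<omega> (cell n q) (cell n q')))"
    proof (rule emeasure_count_space_finite[OF sub])
      show "finite (pairs \<omega> (cell n q) (cell n q'))"
        by (rule finite_subset[of _ "(\<Phi> \<omega> \<inter> cell n q) \<times> (\<Phi> \<omega> \<inter> cell n q')"])
           (use q \<omega> finite_points bounded_borel_cell in \<open>auto simp: pairs_def\<close>)
    qed
    finally show "(\<integral>\<^sup>+z. ?G q q' * (?i (snd z) q' * ?i (fst z) q) \<partial>count_space ?P) \<le> ?G q q' * of_nat (card (pairs \<omega> (cell n q) (cell n q')))"
      by (simp only: nn_integral_cmult borel_measurable_count_space order_refl)
  qed
  finally show ?thesis .
qed

text \<open>One factor \<open>C ^ n\<close> is built into the dominator; the other is paid for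
  returning from the grid sum over \<open>q'\<close> to an integral. The sum over \<open>q\<close>
  then only collects the volume 1 of the unit cube.\<close>

lemma nn_integral_pair_dominator_le:
  assumes [measurable]: "g \<in> borel_measurable borel"
    and g: "\<And>u v. \<bar>u - v\<bar> \<le> 1 / real n \<Longrightarrow> g u \<le> C * g v"
  shows "(\<integral>\<^sup>+\<omega>. pair_dominator g C \<omega> \<partial>M) \<le> C ^ (2 * n) * ennreal (lam\<^sup>2) * (\<integral>\<^sup>+u. g u \<partial>lborel) ^ n"
proof -
  let ?R = "grid n" and ?Q = "grid n \<inter> unit_cube n" and ?e = "\<lambda>q. emeasure (euc n) (cell n q)"
  let ?G = "\<lambda>q q'. C ^ n * (\<Prod>i<n. g (q' i - q i))" and ?J = "\<integral>\<^sup>+u. g u \<partial>lborel"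
  have "(\<integral>\<^sup>+\<omega>. pair_dominator g C \<omega> \<partial>M)
    = (\<integral>\<^sup>+q. \<integral>\<^sup>+q'. \<integral>\<^sup>+\<omega>. ?G q q' * of_nat (card (pairs \<omega> (cell n q) (cell n q'))) \<partial>M \<partial>count_space ?R \<partial>count_space ?Q)"
    (is "_ = ?rhs")
  proof -
    have meas: "(\<lambda>\<omega>. ?G q q' * of_nat (card (pairs \<omega> (cell n q) (cell n q')))) \<in> borel_measurable M"
      if "q \<in> ?R" "q' \<in> ?R" for q q'
    proof -
      note [measurable] = cell_pairs_measurable[OF that]
      show ?thesis by measurable
    qed
    have "(\<integral>\<^sup>+\<omega>. pair_dominator g C \<omega> \<partial>M) = (\<integral>\<^sup>+q. \<integral>\<^sup>+\<omega>. \<integral>\<^sup>+q'. ?G q q' * of_nat (card (pairs \<omega> (cell n q) (cell n q'))) \<partial>count_space ?R \<partial>M \<partial>count_space ?Q)"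
      unfolding pair_dominator_def
      by (rule nn_integral_count_space_nn_integral) (auto intro!: borel_measurable_nn_integral_count_space meas)
    also have "\<dots> = ?rhs"
      by (intro nn_integral_cong nn_integral_count_space_nn_integral) (auto intro!: meas)
    finally show ?thesis .
  qed
  also have "\<dots> \<le> (\<integral>\<^sup>+q. \<integral>\<^sup>+q'. ennreal (lam\<^sup>2) * ?e q * (?G q q' * ?e q') \<partial>count_space ?R \<partial>count_space ?Q)"
  proof (intro nn_integral_mono)
    fix q q' assume "q \<in> space (count_space ?Q)" "q' \<in> space (count_space ?R)"
    then have q: "q \<in> ?R" "q \<in> unit_cube n" "q' \<in> ?R" by auto
    have le: "ennreal (measure (euc n) B) \<le> emeasure (euc n) B" for B
      by (simp add: measure_def ennreal_enn2real_if)
    have "(\<integral>\<^sup>+\<omega>. ?G q q' * of_nat (card (pairs \<omega> (cell n q) (cell n q'))) \<partial>M)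
      = ?G q q' * (ennreal (lam * measure (euc n) (cell n q)) * ennreal (lam * measure (euc n) (cell n q')))"
      using q by (subst nn_integral_cmult, simp add: cell_pairs_measurable, subst expectation_pairs)
        (auto intro: bounded_borel_cell simp: cells_disjoint_or_eq)
    also have "\<dots> \<le> ?G q q' * ((ennreal lam * ?e q) * (ennreal lam * ?e q'))"
      using lam_nonneg by (intro mult_left_mono mult_mono) (auto simp: ennreal_mult intro!: mult_left_mono le)
    also have "\<dots> = ennreal (lam\<^sup>2) * ?e q * (?G q q' * ?e q')"
      using lam_nonneg by (simp add: power2_eq_square ennreal_mult mult_ac)
    finally show "(\<integral>\<^sup>+\<omega>. ?G q q' * of_nat (card (pairs \<omega> (cell n q) (cell n q'))) \<partial>M) \<le> \<dots>" .
  qed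
  also have "\<dots> \<le> (\<integral>\<^sup>+q. ennreal (lam\<^sup>2) * (C ^ n * (C ^ n * ?J ^ n)) * ?e q \<partial>count_space ?Q)"
  proof (intro nn_integral_mono)
    fix q assume "q \<in> space (count_space ?Q)"
    have "(\<integral>\<^sup>+q'. (\<Prod>i<n. g (q' i - q i)) * ?e q' \<partial>count_space ?R) = (\<integral>\<^sup>+y. (\<Prod>i<n. g (grid_round n y i - q i)) \<partial>euc n)"
      by (rule nn_integral_grid_cells)
    also have "\<dots> \<le> (\<integral>\<^sup>+y. C ^ n * (\<Prod>i<n. g (y i - q i)) \<partial>euc n)"
    proof (intro nn_integral_mono prod_le_power_mult g)
      fix y i assume "i < n"
      then show "\<bar>grid_round n y i - q i - (y i - q i)\<bar> \<le> 1 / real n"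
        using grid_round_close[of i n y] by linarith
    qed
    also have "\<dots> = C ^ n * (\<integral>\<^sup>+y. (\<Prod>i<n. g (y i - q i)) \<partial>euc n)"
      by (intro nn_integral_cmult) measurable
    also have "(\<integral>\<^sup>+y. (\<Prod>i<n. g (y i - q i)) \<partial>euc n) = (\<Prod>i<n. \<integral>\<^sup>+u. g (u - q i) \<partial>lborel)"
      by (intro nn_integral_euc_prod) measurable
    also have "\<dots> = ?J ^ n"
      using nn_integral_real_affine[where c=1 and f=g and t="- q _"] by simp
    finally have le: "(\<integral>\<^sup>+q'. (\<Prod>i<n. g (q' i - q i)) * ?e q' \<partial>count_space ?R) \<le> C ^ n * ?J ^ n" .
    have "(\<integral>\<^sup>+q'. ennreal (lam\<^sup>2) * ?e q * (?G q q' * ?e q') \<partial>count_space ?R)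
      = ennreal (lam\<^sup>2) * ?e q * (C ^ n * (\<integral>\<^sup>+q'. (\<Prod>i<n. g (q' i - q i)) * ?e q' \<partial>count_space ?R))"
      by (simp only: nn_integral_cmult borel_measurable_count_space mult.assoc)
    also have "\<dots> \<le> ennreal (lam\<^sup>2) * ?e q * (C ^ n * (C ^ n * ?J ^ n))"
      by (intro mult_left_mono le) auto
    also have "\<dots> = ennreal (lam\<^sup>2) * (C ^ n * (C ^ n * ?J ^ n)) * ?e q"
      by (simp only: mult_ac)
    finally show "(\<integral>\<^sup>+q'. ennreal (lam\<^sup>2) * ?e q * (?G q q' * ?e q') \<partial>count_space ?R)
       \<le> ennreal (lam\<^sup>2) * (C ^ n * (C ^ n * ?J ^ n)) * ?e q" .
  qed
  also have "\<dots> = ennreal (lam\<^sup>2) * (C ^ n * (C ^ n * ?J ^ n))"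
    by (subst nn_integral_cmult) (simp_all add: sum_cells_unit_cube)
  finally show ?thesis by (subst mult_2, subst power_add) (simp only: mult_ac)
qed

end

section \<open>Intensity of the Matern process\<close>

lemma norm1_measurable [measurable]: "norm1 n \<in> borel_measurable (euc n)"
  unfolding norm1_def[abs_def] by measurable

lemma vdiff_in_space [simp]: "vdiff n x y \<in> space (euc n)"
  by (simp add: vdiff_def space_euc)

lemma norm1_vdiff_commute: "norm1 n (vdiff n x y) = norm1 n (vdiff n y x)"
  by (simp add: norm1_def vdiff_def abs_minus_commute)

lemma norm1_le_add: "norm1 n x \<le> norm1 n y + norm1 n (vdiff n x y)"
  unfolding norm1_def sum.distrib[symmetric] by (intro sum_mono) (simp add: vdiff_def)

lemma norm1_vdiff_origin: "norm1 n (vdiff n x (origin n)) = norm1 n x"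
  by (simp add: norm1_def vdiff_def origin_def)

lemma vdiff_self: "vdiff n x x = origin n"
  by (simp add: vdiff_def origin_def)

lemma vdiff_eq_origin_iff:
  assumes "x \<in> space (euc n)" "y \<in> space (euc n)"
  shows "vdiff n x y = origin n \<longleftrightarrow> x = y"
proof
  assume "vdiff n x y = origin n"
  then have "x i = y i" if "i < n" for i
    using that by (auto simp: vdiff_def origin_def fun_eq_iff split: if_splits)
  with assms show "x = y"
    unfolding space_euc by (intro PiE_ext) auto
qed (simp add: vdiff_self)

lemma bounded_borel_ball: "bounded_borel n {x \<in> space (euc n). norm1 n (vdiff n x a) \<le> c}"
  unfolding bounded_borel_def
proof (intro conjI exI ballI)
  have "{x \<in> space (euc n). (\<Sum>i<n. \<bar>x i - a i\<bar>) \<le> c} \<in> sets (euc n)"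
    by measurable
  then show "{x \<in> space (euc n). norm1 n (vdiff n x a) \<le> c} \<in> sets (euc n)"
    by (simp add: norm1_def vdiff_def)
  fix x assume "x \<in> {x \<in> space (euc n). norm1 n (vdiff n x a) \<le> c}"
  then show "norm1 n x \<le> norm1 n a + c"
    using norm1_le_add[of n x a] by simp
qed

text \<open>If every other point were strictly farther from \<open>d\<close> than the origin is,
  strictness could still be lost in an infimum over infinitely many points. Local finiteness
  prevents this: only finitely many points lie within \<open>norm1 n d + 1\<close> of
  \<open>d\<close>.\<close>

lemma decoding_error_imp_competitor:
  assumes \<Psi>: "\<Psi> \<subseteq> space (euc n)" and fin: "\<And>B. bounded_borel n B \<Longrightarrow> finite (\<Psi> \<inter> B)"
    and x: "x \<in> \<Psi>" and d: "d \<in> space (euc n)"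
    and err: "d \<notin> decoding_region n ((\<lambda>t. vdiff n t x) ` \<Psi>) (origin n)"
  shows "\<exists>t\<in>\<Psi> - {x}. norm1 n (vdiff n d (vdiff n t x)) \<le> norm1 n d"
proof (rule ccontr)
  assume "\<not> ?thesis"
  then have far: "norm1 n d < norm1 n (vdiff n d (vdiff n t x))" if "t \<in> \<Psi>" "t \<noteq> x" for t
    using that by force
  define F where "F = {t \<in> \<Psi> - {x}. norm1 n (vdiff n d (vdiff n t x)) \<le> norm1 n d + 1}"
  \<comment> \<open>The inserted value keeps the minimum defined when \<open>F\<close> is empty and
    is a lower bound for the distances of the points outside \<open>F\<close>.\<close>
  define m where "m = Min (insert (norm1 n d + 1) ((\<lambda>t. norm1 n (vdiff n d (vdiff n t x))) ` F))"
  have "F \<subseteq> \<Psi> \<inter> {t \<in> space (euc n). norm1 n (vdiff n t x) \<le> norm1 n d + (norm1 n d + 1)}"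
  proof
    fix t assume "t \<in> F"
    then show "t \<in> \<Psi> \<inter> {t \<in> space (euc n). norm1 n (vdiff n t x) \<le> norm1 n d + (norm1 n d + 1)}"
      using \<Psi> norm1_le_add[of n "vdiff n t x" d] norm1_vdiff_commute[of n d "vdiff n t x"]
      by (auto simp: F_def)
  qed
  then have "finite F" using fin[OF bounded_borel_ball] finite_subset by blast
  then have "norm1 n d < m"
    unfolding m_def by (subst Min_gr_iff) (auto simp: F_def far)
  also have "ereal m \<le> (INF s\<in>(\<lambda>t. vdiff n t x) ` \<Psi> - {origin n}. ereal (norm1 n (vdiff n d s)))"
  proof (rule INF_greatest)
    fix s assume "s \<in> (\<lambda>t. vdiff n t x) ` \<Psi> - {origin n}"
    then obtain t where t: "t \<in> \<Psi>" "t \<noteq> x" "s = vdiff n t x"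
      using vdiff_self by blast
    have "m \<le> norm1 n (vdiff n d s)"
    proof (cases "t \<in> F")
      case True
      then show ?thesis using \<open>finite F\<close> unfolding m_def t(3) by (intro Min_le) auto
    next
      case False
      have "m \<le> norm1 n d + 1" using \<open>finite F\<close> unfolding m_def by (intro Min_le) auto
      with False t show ?thesis by (auto simp: F_def)
    qed
    then show "ereal m \<le> ereal (norm1 n (vdiff n d s))" by simp
  qed
  finally have "strictly_closest n ((\<lambda>t. vdiff n t x) ` \<Psi>) (origin n) d"
    by (simp add: strictly_closest_def norm1_vdiff_origin)
  with err d show False by (simp add: decoding_region_def)
qed

lemma nn_integral_count_space_mono_set:
  assumes "A \<subseteq> B"
  shows "(\<integral>\<^sup>+x. f x \<partial>count_space A) \<le> (\<integral>\<^sup>+x. f x \<partial>count_space B)"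
proof -
  have "(\<integral>\<^sup>+x. f x * indicator A x \<partial>count_space UNIV) \<le> (\<integral>\<^sup>+x. f x * indicator B x \<partial>count_space UNIV)"
    using assms by (intro nn_integral_mono) (auto simp: indicator_def)
  moreover have "(\<integral>\<^sup>+x. f x \<partial>count_space A) = (\<integral>\<^sup>+x. f x * indicator A x \<partial>count_space UNIV)" for A
    by (simp add: nn_integral_count_space_indicator)
  ultimately show ?thesis by simp
qed

lemma nn_integral_count_space_inj_le:
  assumes "inj_on h A" "h ` A \<subseteq> B"
  shows "(\<integral>\<^sup>+x. f (h x) \<partial>count_space A) \<le> (\<integral>\<^sup>+x. f x \<partial>count_space B)"
  using nn_integral_bij_count_space[OF inj_on_imp_bij_betw[OF assms(1)], of f]
    nn_integral_count_space_mono_set[OF assms(2), of f] by simp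

locale matern_process = poisson_points +
  fixes r :: real and T :: "nat \<Rightarrow> 'a \<Rightarrow> pt"
  assumes enum: "enumeration M n T (\<lambda>\<omega>. matern n r (\<Phi> \<omega>))"
begin

lemma T_measurable [measurable]: "T k \<in> M \<rightarrow>\<^sub>M euc n"
  using enum by (simp add: enumeration_def)

lemma AE_enumeration: "AE \<omega> in M. inj (\<lambda>k. T k \<omega>) \<and> range (\<lambda>k. T k \<omega>) = matern n r (\<Phi> \<omega>)"
  using enum by (simp add: enumeration_def)

lemma sum_enumeration_cube:
  assumes \<omega>: "\<omega> \<in> space M" and inj: "inj (\<lambda>k. T k \<omega>)" and ran: "range (\<lambda>k. T k \<omega>) = matern n r (\<Phi> \<omega>)"
  shows "(\<Sum>k. indicator (unit_cube n) (T k \<omega>)) = (of_nat (card (matern n r (\<Phi> \<omega>) \<inter> unit_cube n)) :: ennreal)"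
proof -
  let ?K = "{k. T k \<omega> \<in> unit_cube n}"
  have bij: "bij_betw (\<lambda>k. T k \<omega>) ?K (matern n r (\<Phi> \<omega>) \<inter> unit_cube n)"
    using inj ran by (auto simp: bij_betw_def inj_on_def)
  have fin: "finite (matern n r (\<Phi> \<omega>) \<inter> unit_cube n)"
    by (rule finite_subset[OF _ finite_points[OF bounded_borel_unit_cube \<omega>]]) (auto simp: matern_def)
  have "(\<Sum>k. indicator (unit_cube n) (T k \<omega>)) = (\<integral>\<^sup>+k. indicator ?K k \<partial>count_space UNIV)"
    by (subst nn_integral_count_space_nat) (auto intro!: arg_cong[where f=suminf] simp: indicator_def)
  also have "\<dots> = of_nat (card ?K)"
    using bij_betw_finite[OF bij] fin by (simp add: emeasure_count_space_finite)
  finally show ?thesis using bij_betw_same_card[OF bij] by simp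
qed

lemma intensity_le: "intensity M n T \<le> ennreal lam"
proof -
  have "intensity M n T \<le> (\<integral>\<^sup>+\<omega>. of_nat (card (\<Phi> \<omega> \<inter> unit_cube n)) \<partial>M)"
    unfolding intensity_def
  proof (rule nn_integral_mono_AE, use AE_enumeration AE_space in eventually_elim)
    case (elim \<omega>)
    have "card (matern n r (\<Phi> \<omega>) \<inter> unit_cube n) \<le> card (\<Phi> \<omega> \<inter> unit_cube n)"
      using finite_points[OF bounded_borel_unit_cube] elim by (intro card_mono) (auto simp: matern_def)
    then show ?case using elim by (simp add: sum_enumeration_cube)
  qed
  then show ?thesis
    by (simp add: expectation_count bounded_borel_unit_cube measure_def emeasure_unit_cube)
qed

text \<open>A deleted point \<open>x\<close> has some Poisson point \<open>s x\<close> within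
  distance \<open>r\<close>, and \<open>x\<close> is recovered from the pair
  \<open>(x, s x)\<close>. So the deleted points in the cube are at most as many as the close pairs,
  which \<open>g\<close> counts with weight at least 1.\<close>

lemma lam_le_intensity_add:
  assumes [measurable]: "g \<in> borel_measurable borel"
    and g: "\<And>u v. \<bar>u - v\<bar> \<le> 1 / real n \<Longrightarrow> g u \<le> C * g v"
    and close: "\<And>y. norm1 n y < r \<Longrightarrow> 1 \<le> (\<Prod>i<n. g (y i))"
  shows "ennreal lam \<le> intensity M n T + C ^ (2 * n) * ennreal (lam\<^sup>2) * (\<integral>\<^sup>+u. g u \<partial>lborel) ^ n"
proof -
  have "ennreal lam = (\<integral>\<^sup>+\<omega>. of_nat (card (\<Phi> \<omega> \<inter> unit_cube n)) \<partial>M)"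
    by (simp add: expectation_count bounded_borel_unit_cube measure_def emeasure_unit_cube)
  also have "\<dots> \<le> (\<integral>\<^sup>+\<omega>. (\<Sum>k. indicator (unit_cube n) (T k \<omega>)) + pair_dominator g C \<omega> \<partial>M)"
  proof (rule nn_integral_mono_AE, use AE_enumeration AE_space in eventually_elim)
    case (elim \<omega>)
    let ?\<Psi> = "matern n r (\<Phi> \<omega>)"
    define X where "X = (\<Phi> \<omega> - ?\<Psi>) \<inter> unit_cube n"
    have fin: "finite (\<Phi> \<omega> \<inter> unit_cube n)"
      using finite_points[OF bounded_borel_unit_cube] elim by auto
    have "\<forall>x\<in>X. \<exists>s\<in>\<Phi> \<omega>. s \<noteq> x \<and> norm1 n (vdiff n s x) < r"
      by (auto simp: X_def matern_def)
    then obtain s where s: "\<And>x. x \<in> X \<Longrightarrow> s x \<in> \<Phi> \<omega> \<and> s x \<noteq> x \<and> norm1 n (vdiff n (s x) x) < r"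
      by metis
    have "of_nat (card X) = (\<integral>\<^sup>+x. 1 \<partial>count_space X)"
      using fin by (subst nn_integral_const, subst emeasure_count_space_finite) (auto simp: X_def intro: finite_subset[OF _ fin])
    also have "\<dots> \<le> (\<integral>\<^sup>+x. (\<Prod>i<n. g (s x i - x i)) \<partial>count_space X)"
    proof (intro nn_integral_mono)
      fix x assume "x \<in> space (count_space X)"
      then show "1 \<le> (\<Prod>i<n. g (s x i - x i))"
        using close[of "vdiff n (s x) x"] s[of x] by (simp add: vdiff_def)
    qed
    also have "\<dots> \<le> (\<integral>\<^sup>+z. (\<Prod>i<n. g (snd z i - fst z i)) \<partial>count_space (pairs \<omega> (unit_cube n) UNIV))"
      using nn_integral_count_space_inj_le[of "\<lambda>x. (x, s x)" X "pairs \<omega> (unit_cube n) UNIV" "\<lambda>z. \<Prod>i<n. g (snd z i - fst z i)"] s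
      by (fastforce simp: inj_on_def pairs_def X_def)
    also have "\<dots> \<le> pair_dominator g C \<omega>"
      using g elim by (intro pairs_le_pair_dominator) auto
    finally have X: "of_nat (card X) \<le> pair_dominator g C \<omega>" .
    have "\<Phi> \<omega> \<inter> unit_cube n = (?\<Psi> \<inter> unit_cube n) \<union> X"
      by (auto simp: X_def matern_def)
    then have "card (\<Phi> \<omega> \<inter> unit_cube n) \<le> card (?\<Psi> \<inter> unit_cube n) + card X"
      by (metis card_Un_le)
    then have "(of_nat (card (\<Phi> \<omega> \<inter> unit_cube n)) :: ennreal) \<le> of_nat (card (?\<Psi> \<inter> unit_cube n)) + of_nat (card X)"
      unfolding of_nat_add[symmetric] by (rule of_nat_mono)
    also have "\<dots> \<le> (\<Sum>k. indicator (unit_cube n) (T k \<omega>)) + pair_dominator g C \<omega>"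
      using X elim by (simp add: sum_enumeration_cube)
    finally show ?case .
  qed
  also have "\<dots> = intensity M n T + (\<integral>\<^sup>+\<omega>. pair_dominator g C \<omega> \<partial>M)"
    unfolding intensity_def by (intro nn_integral_add) measurable
  also have "\<dots> \<le> intensity M n T + C ^ (2 * n) * ennreal (lam\<^sup>2) * (\<integral>\<^sup>+u. g u \<partial>lborel) ^ n"
    using g by (intro add_left_mono nn_integral_pair_dominator_le) auto
  finally show ?thesis .
qed

end

section \<open>Union bound for the decoding error\<close>

locale marked_matern_process = matern_process +
  fixes D :: "nat \<Rightarrow> 'a \<Rightarrow> pt" and f :: "real \<Rightarrow> ennreal"
  assumes f_measurable [measurable]: "f \<in> borel_measurable borel"
    and f_prob: "prob_space (density lborel f)"
    and marks: "iid_marks M n T D (\<Pi>\<^sub>M i\<in>{..<n}. density lborel f)"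
begin

abbreviation noise :: "pt measure" where
  "noise \<equiv> \<Pi>\<^sub>M i\<in>{..<n}. density lborel f"

lemma sets_noise [measurable_cong]: "sets noise = sets (euc n)"
  unfolding euc_def by (intro sets_PiM_cong) auto

lemma D_measurable [measurable]: "D k \<in> M \<rightarrow>\<^sub>M euc n"
  using marks by (auto simp: iid_marks_def indep_vars_def)

lemma distr_D: "distr M (euc n) (D k) = noise"
  using marks by (simp add: iid_marks_def)

lemma nn_integral_noise_prod:
  assumes "\<And>i. i < n \<Longrightarrow> h i \<in> borel_measurable borel"
  shows "(\<integral>\<^sup>+d. (\<Prod>i<n. h i (d i)) \<partial>noise) = (\<Prod>i<n. \<integral>\<^sup>+x. f x * h i x \<partial>lborel)"
proof -
  interpret product_sigma_finite "\<lambda>_::nat. density lborel f"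
    using f_prob by (auto simp: product_sigma_finite_def intro: prob_space_imp_sigma_finite)
  have "(\<integral>\<^sup>+d. (\<Prod>i<n. h i (d i)) \<partial>noise) = (\<Prod>i<n. \<integral>\<^sup>+x. h i x \<partial>density lborel f)"
    using assms by (intro product_nn_integral_prod) auto
  also have "\<dots> = (\<Prod>i<n. \<integral>\<^sup>+x. f x * h i x \<partial>lborel)"
    using assms by (intro prod.cong) (auto simp: nn_integral_density)
  finally show ?thesis .
qed

text \<open>Independence is given for the whole sequences \<open>T\<close> and \<open>D\<close>.
  Fubini is applied to their joint law on the product of the sequence spaces, and then the inner
  integral is projected to the single mark \<open>D k\<close>.\<close>

lemma nn_integral_points_mark:
  assumes [measurable]: "(\<lambda>z. h (fst z) (snd z)) \<in> borel_measurable ((euc n \<Otimes>\<^sub>M euc n) \<Otimes>\<^sub>M euc n)"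
  shows "(\<integral>\<^sup>+\<omega>. h (T k \<omega>, T l \<omega>) (D k \<omega>) \<partial>M) = (\<integral>\<^sup>+\<omega>. (\<integral>\<^sup>+d. h (T k \<omega>, T l \<omega>) d \<partial>noise) \<partial>M)"
proof -
  let ?S = "\<Pi>\<^sub>M k\<in>(UNIV::nat set). euc n"
  let ?T = "\<lambda>\<omega> k. T k \<omega>" and ?D = "\<lambda>\<omega> k. D k \<omega>"
  have meas [measurable]: "?T \<in> M \<rightarrow>\<^sub>M ?S" "?D \<in> M \<rightarrow>\<^sub>M ?S"
    by (auto intro!: measurable_PiM_single')
       (auto simp: space_PiM PiE_iff dest: measurable_space[OF T_measurable] measurable_space[OF D_measurable])
  have "indep_var ?S ?T ?S ?D"
    using marks by (simp add: iid_marks_def)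
  then have joint: "distr M (?S \<Otimes>\<^sub>M ?S) (\<lambda>\<omega>. (?T \<omega>, ?D \<omega>)) = distr M ?S ?T \<Otimes>\<^sub>M distr M ?S ?D"
    by (simp add: indep_var_distribution_eq)
  interpret DD: prob_space "distr M ?S ?D" by (rule prob_space_distr) measurable
  let ?h = "\<lambda>t d. h (t k, t l) (d k)"
  have h [measurable]: "(\<lambda>z. ?h (fst z) (snd z)) \<in> borel_measurable (?S \<Otimes>\<^sub>M ?S)"
    using measurable_compose[OF _ assms, of "\<lambda>z. ((fst z k, fst z l), snd z k)" "?S \<Otimes>\<^sub>M ?S"] by simp
  have "(\<integral>\<^sup>+\<omega>. h (T k \<omega>, T l \<omega>) (D k \<omega>) \<partial>M)
    = (\<integral>\<^sup>+z. ?h (fst z) (snd z) \<partial>distr M (?S \<Otimes>\<^sub>M ?S) (\<lambda>\<omega>. (?T \<omega>, ?D \<omega>)))"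
    by (subst nn_integral_distr) auto
  also have "\<dots> = (\<integral>\<^sup>+t. \<integral>\<^sup>+d. ?h t d \<partial>distr M ?S ?D \<partial>distr M ?S ?T)"
    unfolding joint by (subst DD.nn_integral_fst[symmetric]) auto
  also have "\<dots> = (\<integral>\<^sup>+\<omega>. \<integral>\<^sup>+d. ?h (?T \<omega>) d \<partial>distr M ?S ?D \<partial>M)"
    by (subst nn_integral_distr) (auto intro!: DD.borel_measurable_nn_integral simp: case_prod_unfold)
  also have "\<dots> = (\<integral>\<^sup>+\<omega>. (\<integral>\<^sup>+d. h (T k \<omega>, T l \<omega>) d \<partial>noise) \<partial>M)"
  proof (intro nn_integral_cong)
    fix \<omega> assume \<omega>: "\<omega> \<in> space M"
    then have t: "(T k \<omega>, T l \<omega>) \<in> space (euc n \<Otimes>\<^sub>M euc n)"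
      using measurable_space[OF T_measurable] by (auto simp: space_pair_measure)
    have "(\<lambda>d. h (T k \<omega>, T l \<omega>) d) \<in> borel_measurable (euc n)"
      using measurable_compose[OF measurable_Pair1'[OF t] assms] by simp
    then show "(\<integral>\<^sup>+d. ?h (?T \<omega>) d \<partial>distr M ?S ?D) = (\<integral>\<^sup>+d. h (T k \<omega>, T l \<omega>) d \<partial>noise)"
      unfolding distr_D[of k, symmetric] by (subst (1 2) nn_integral_distr) simp_all
  qed
  finally show ?thesis .
qed

text \<open>Passing from Matern pairs to all Poisson pairs only adds nonnegative terms, and moments
  are available only for the latter. Injectivity of the enumeration ensures that no pair is counted
  twice.\<close>

lemma sum_pairs_le_pair_dominator:
  assumes g: "\<And>u v. \<bar>u - v\<bar> \<le> 1 / real n \<Longrightarrow> g u \<le> C * g v"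
    and \<omega>: "\<omega> \<in> space M" and inj: "inj (\<lambda>k. T k \<omega>)" and ran: "range (\<lambda>k. T k \<omega>) = matern n r (\<Phi> \<omega>)"
  shows "(\<Sum>k. \<Sum>l. if l = k then 0 else indicator (unit_cube n) (T k \<omega>) * (\<Prod>i<n. g (T l \<omega> i - T k \<omega> i)))
     \<le> pair_dominator g C \<omega>"
proof -
  let ?S = "{(k, l). k \<noteq> l \<and> T k \<omega> \<in> unit_cube n}"
  let ?g = "\<lambda>z. \<Prod>i<n. g (snd z i - fst z i)" and ?T = "\<lambda>(k, l). (T k \<omega>, T l \<omega>)"
  have sub: "T k \<omega> \<in> \<Phi> \<omega>" for k
    using rangeI[of "\<lambda>k. T k \<omega>" k] unfolding ran by (auto simp: matern_def)
  have "(\<Sum>k. \<Sum>l. if l = k then 0 else indicator (unit_cube n) (T k \<omega>) * (\<Prod>i<n. g (T l \<omega> i - T k \<omega> i)))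
      = (\<integral>\<^sup>+k. \<integral>\<^sup>+l. ?g (?T (k, l)) * indicator ?S (k, l) \<partial>count_space UNIV \<partial>count_space UNIV)"
    unfolding nn_integral_count_space_nat[symmetric]
    by (intro nn_integral_cong) (auto simp: indicator_def)
  also have "\<dots> = (\<integral>\<^sup>+p. ?g (?T p) * indicator ?S p \<partial>count_space UNIV)"
    by (subst nn_integral_fst_count_space) (simp add: case_prod_unfold)
  also have "\<dots> = (\<integral>\<^sup>+p. ?g (?T p) \<partial>count_space ?S)"
    by (simp add: nn_integral_count_space_indicator)
  also have "\<dots> \<le> (\<integral>\<^sup>+z. ?g z \<partial>count_space (pairs \<omega> (unit_cube n) UNIV))"
    using sub inj by (intro nn_integral_count_space_inj_le) (auto simp: inj_on_def pairs_def)
  also have "\<dots> \<le> pair_dominator g C \<omega>"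
    using g \<omega> by (intro pairs_le_pair_dominator)
  finally show ?thesis .
qed

lemma decoding_error_imp_pair:
  assumes \<omega>: "\<omega> \<in> space M" and inj: "inj (\<lambda>k. T k \<omega>)" and ran: "range (\<lambda>k. T k \<omega>) = matern n r (\<Phi> \<omega>)"
    and err: "shift_marked n (T k \<omega>) (range (\<lambda>l. (T l \<omega>, D l \<omega>))) \<in> decoding_error n"
  obtains l where "l \<noteq> k" "norm1 n (vdiff n (D k \<omega>) (vdiff n (T l \<omega>) (T k \<omega>))) \<le> norm1 n (D k \<omega>)"
    "r \<le> norm1 n (vdiff n (T l \<omega>) (T k \<omega>))"
proof -
  let ?\<Psi> = "matern n r (\<Phi> \<omega>)"
  have sp: "T l \<omega> \<in> space (euc n)" "D l \<omega> \<in> space (euc n)" for l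
    using measurable_space[OF T_measurable \<omega>] measurable_space[OF D_measurable \<omega>] by auto
  have mem: "T l \<omega> \<in> ?\<Psi>" for l
    using rangeI[of "\<lambda>k. T k \<omega>" l] unfolding ran .
  have "fst ` shift_marked n (T k \<omega>) (range (\<lambda>l. (T l \<omega>, D l \<omega>))) = (\<lambda>t. vdiff n t (T k \<omega>)) ` ?\<Psi>"
    unfolding ran[symmetric] by (auto simp: shift_marked_def image_image)
  with err obtain l where l: "vdiff n (T l \<omega>) (T k \<omega>) = origin n"
    "D l \<omega> \<notin> decoding_region n ((\<lambda>t. vdiff n t (T k \<omega>)) ` ?\<Psi>) (origin n)"
    by (auto simp: decoding_error_def shift_marked_def)
  \<comment> \<open>The error event speaks of some mark sitting at the origin; as the points are
    distinct, this can only be the mark of the point used for recentring.\<close>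
  then have "l = k"
    using inj sp by (auto simp: vdiff_eq_origin_iff inj_def)
  have fin: "finite (?\<Psi> \<inter> B)" if "bounded_borel n B" for B
    by (rule finite_subset[OF _ finite_points[OF that \<omega>]]) (auto simp: matern_def)
  have "\<exists>t\<in>?\<Psi> - {T k \<omega>}. norm1 n (vdiff n (D k \<omega>) (vdiff n t (T k \<omega>))) \<le> norm1 n (D k \<omega>)"
    using l points_in_space[OF \<omega>] unfolding \<open>l = k\<close>
    by (intro decoding_error_imp_competitor fin mem sp) (auto simp: matern_def)
  then obtain m where m: "T m \<omega> \<noteq> T k \<omega>"
    "norm1 n (vdiff n (D k \<omega>) (vdiff n (T m \<omega>) (T k \<omega>))) \<le> norm1 n (D k \<omega>)"
    unfolding ran[symmetric] by auto
  have "r \<le> norm1 n (vdiff n (T m \<omega>) (T k \<omega>))"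
    using mem[of m] mem[of k] m(1) by (auto simp: matern_def not_less)
  with m show ?thesis by (intro that[of m]) auto
qed

text \<open>Noise in the exceptional set \<open>A\<close> is counted as an error outright. Otherwise
  some competitor exists, and its indicator is dominated by a product over coordinates, so that
  integrating out the mark again yields a product, with factors \<open>g\<close>.\<close>

lemma error_prob_union_bound:
  assumes A [measurable]: "A \<in> sets (euc n)"
    and \<eta> [measurable]: "(\<lambda>z. \<eta> (fst z) (snd z)) \<in> borel_measurable (borel \<Otimes>\<^sub>M borel)"
    and cover: "\<And>d y. d \<in> space (euc n) \<Longrightarrow> d \<notin> A \<Longrightarrow> norm1 n (vdiff n d y) \<le> norm1 n d
      \<Longrightarrow> r \<le> norm1 n y \<Longrightarrow> (1::ennreal) \<le> (\<Prod>i<n. \<eta> (d i) (y i))"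
    and g: "\<And>u. g u = (\<integral>\<^sup>+x. f x * \<eta> x u \<partial>lborel)"
    and C: "\<And>u v. \<bar>u - v\<bar> \<le> 1 / real n \<Longrightarrow> g u \<le> C * g v"
  shows "error_prob M n T D \<le> (intensity M n T * emeasure noise A
     + C ^ (2 * n) * ennreal (lam\<^sup>2) * (\<integral>\<^sup>+u. g u \<partial>lborel) ^ n) / intensity M n T"
proof -
  let ?c = "\<lambda>k \<omega>. indicator (unit_cube n) (T k \<omega>) :: ennreal"
  let ?e = "\<lambda>k l \<omega>. if l = k then 0 else ?c k \<omega> * (\<Prod>i<n. \<eta> (D k \<omega> i) (T l \<omega> i - T k \<omega> i))"
  have \<eta>m: "(\<lambda>\<omega>. \<eta> (a \<omega>) (b \<omega>)) \<in> borel_measurable N"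
    if [measurable]: "a \<in> borel_measurable N" "b \<in> borel_measurable N" for a b and N :: "'z measure"
    using measurable_compose[OF measurable_Pair[OF that] \<eta>] by simp
  have g_meas: "g \<in> borel_measurable borel"
  proof -
    have "(\<lambda>u. \<integral>\<^sup>+x. f x * \<eta> x u \<partial>lborel) \<in> borel_measurable borel"
      using \<eta> by (intro lborel.borel_measurable_nn_integral) (simp add: case_prod_unfold, intro borel_measurable_times_ennreal \<eta>m; measurable)
    then show ?thesis by (simp add: g[abs_def])
  qed
  have comp: "(\<lambda>\<omega>. T k \<omega> i) \<in> borel_measurable M" "(\<lambda>\<omega>. D k \<omega> i) \<in> borel_measurable M" if "i < n" for k i
    using measurable_compose[OF T_measurable euc_component_measurable[OF that]]
      measurable_compose[OF D_measurable euc_component_measurable[OF that]] by auto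
  have e_meas [measurable]: "?e k l \<in> borel_measurable M" for k l
  proof (cases "l = k")
    case False
    have [measurable]: "(\<lambda>\<omega>. \<eta> (D k \<omega> i) (T l \<omega> i - T k \<omega> i)) \<in> borel_measurable M" if "i \<in> {..<n}" for i
      using that by (intro \<eta>m borel_measurable_diff comp) auto
    show ?thesis using False by simp
  qed simp
  \<comment> \<open>Measurability of the error event is never established.
    \<open>nn_integral\<close> is monotone for arbitrary integrands, and all later manipulations
    concern the measurable right-hand side.\<close>
  have "(\<integral>\<^sup>+\<omega>. (\<Sum>k. indicator {k. T k \<omega> \<in> unit_cube n \<and>
        shift_marked n (T k \<omega>) (range (\<lambda>l. (T l \<omega>, D l \<omega>))) \<in> decoding_error n} k) \<partial>M)
    \<le> (\<integral>\<^sup>+\<omega>. (\<Sum>k. ?c k \<omega> * indicator A (D k \<omega>) + (\<Sum>l. ?e k l \<omega>)) \<partial>M)"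
  proof (rule nn_integral_mono_AE, use AE_enumeration AE_space in eventually_elim)
    case (elim \<omega>)
    show ?case
    proof (intro suminf_le allI)
      fix k
      show "indicator {k. T k \<omega> \<in> unit_cube n \<and>
        shift_marked n (T k \<omega>) (range (\<lambda>l. (T l \<omega>, D l \<omega>))) \<in> decoding_error n} k
        \<le> ?c k \<omega> * indicator A (D k \<omega>) + (\<Sum>l. ?e k l \<omega>)" (is "indicator ?K k \<le> _")
      proof (cases "k \<in> ?K \<and> D k \<omega> \<notin> A")
        case True
        then obtain l where l: "l \<noteq> k" "norm1 n (vdiff n (D k \<omega>) (vdiff n (T l \<omega>) (T k \<omega>))) \<le> norm1 n (D k \<omega>)"
          "r \<le> norm1 n (vdiff n (T l \<omega>) (T k \<omega>))"
          using decoding_error_imp_pair[of \<omega> k] elim by auto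
        then have "1 \<le> (\<Prod>i<n. \<eta> (D k \<omega> i) (vdiff n (T l \<omega>) (T k \<omega>) i))"
          using True elim measurable_space[OF D_measurable] by (intro cover) auto
        then have "1 \<le> ?e k l \<omega>" using l(1) True by (simp add: vdiff_def)
        also have "\<dots> \<le> (\<Sum>l. ?e k l \<omega>)"
          using sum_le_suminf[of "\<lambda>l. ?e k l \<omega>" "{l}"] by simp
        finally show ?thesis using True by (simp add: add_increasing)
      qed (auto simp: indicator_def)
    qed auto
  qed
  also have "\<dots> = (\<integral>\<^sup>+\<omega>. (\<Sum>k. ?c k \<omega> * indicator A (D k \<omega>)) + (\<Sum>k. \<Sum>l. ?e k l \<omega>) \<partial>M)"
    by (simp add: suminf_add)
  also have "\<dots> = (\<integral>\<^sup>+\<omega>. (\<Sum>k. ?c k \<omega> * indicator A (D k \<omega>)) \<partial>M) + (\<integral>\<^sup>+\<omega>. (\<Sum>k. \<Sum>l. ?e k l \<omega>) \<partial>M)"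
    by (intro nn_integral_add) measurable
  also have "(\<integral>\<^sup>+\<omega>. (\<Sum>k. ?c k \<omega> * indicator A (D k \<omega>)) \<partial>M) = intensity M n T * emeasure noise A"
  proof -
    have "(\<integral>\<^sup>+\<omega>. ?c k \<omega> * indicator A (D k \<omega>) \<partial>M) = (\<integral>\<^sup>+\<omega>. ?c k \<omega> \<partial>M) * emeasure noise A" for k
    proof -
      have "(\<integral>\<^sup>+\<omega>. ?c k \<omega> * indicator A (D k \<omega>) \<partial>M) = (\<integral>\<^sup>+\<omega>. \<integral>\<^sup>+d. ?c k \<omega> * indicator A d \<partial>noise \<partial>M)"
        using nn_integral_points_mark[of "\<lambda>t d. indicator (unit_cube n) (fst t) * indicator A d" k k] by simp
      also have "\<dots> = (\<integral>\<^sup>+\<omega>. ?c k \<omega> * emeasure noise A \<partial>M)"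
        using A by (simp add: nn_integral_cmult sets_noise)
      also have "\<dots> = (\<integral>\<^sup>+\<omega>. ?c k \<omega> \<partial>M) * emeasure noise A"
        by (intro nn_integral_multc) measurable
      finally show ?thesis .
    qed
    then show ?thesis
      unfolding intensity_def by (simp add: nn_integral_suminf flip: ennreal_suminf_multc)
  qed
  \<comment> \<open>Independence removes the mark \<open>D k\<close> here, before the points are
    enlarged to all of \<open>\<Phi>\<close>, where no marks are attached.\<close>
  also have "(\<integral>\<^sup>+\<omega>. (\<Sum>k. \<Sum>l. ?e k l \<omega>) \<partial>M)
     = (\<integral>\<^sup>+\<omega>. (\<Sum>k. \<Sum>l. if l = k then 0 else ?c k \<omega> * (\<Prod>i<n. g (T l \<omega> i - T k \<omega> i))) \<partial>M)"
  proof -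
    have eq: "(\<integral>\<^sup>+\<omega>. ?e k l \<omega> \<partial>M) = (\<integral>\<^sup>+\<omega>. (if l = k then 0 else ?c k \<omega> * (\<Prod>i<n. g (T l \<omega> i - T k \<omega> i))) \<partial>M)" for k l
    proof (cases "l = k")
      case False
      let ?h = "\<lambda>t d. indicator (unit_cube n) (fst t) * (\<Prod>i<n. \<eta> (d i) (snd t i - fst t i))"
      have "(\<lambda>z. ?h (fst z) (snd z)) \<in> borel_measurable ((euc n \<Otimes>\<^sub>M euc n) \<Otimes>\<^sub>M euc n)"
        by (intro borel_measurable_times_ennreal borel_measurable_prod_ennreal \<eta>m; measurable)
      then have "(\<integral>\<^sup>+\<omega>. ?c k \<omega> * (\<Prod>i<n. \<eta> (D k \<omega> i) (T l \<omega> i - T k \<omega> i)) \<partial>M)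
        = (\<integral>\<^sup>+\<omega>. \<integral>\<^sup>+d. ?c k \<omega> * (\<Prod>i<n. \<eta> (d i) (T l \<omega> i - T k \<omega> i)) \<partial>noise \<partial>M)"
        using nn_integral_points_mark[of ?h k l] by simp
      also have "\<dots> = (\<integral>\<^sup>+\<omega>. ?c k \<omega> * (\<Prod>i<n. g (T l \<omega> i - T k \<omega> i)) \<partial>M)"
      proof (intro nn_integral_cong)
        fix \<omega>
        have "(\<integral>\<^sup>+d. ?c k \<omega> * (\<Prod>i<n. \<eta> (d i) (T l \<omega> i - T k \<omega> i)) \<partial>noise)
          = ?c k \<omega> * (\<integral>\<^sup>+d. (\<Prod>i<n. \<eta> (d i) (T l \<omega> i - T k \<omega> i)) \<partial>noise)"
          by (intro nn_integral_cmult borel_measurable_prod_ennreal \<eta>m; measurable)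
        also have "(\<integral>\<^sup>+d. (\<Prod>i<n. \<eta> (d i) (T l \<omega> i - T k \<omega> i)) \<partial>noise) = (\<Prod>i<n. g (T l \<omega> i - T k \<omega> i))"
          unfolding g by (intro nn_integral_noise_prod \<eta>m; measurable)
        finally show "(\<integral>\<^sup>+d. ?c k \<omega> * (\<Prod>i<n. \<eta> (d i) (T l \<omega> i - T k \<omega> i)) \<partial>noise)
          = ?c k \<omega> * (\<Prod>i<n. g (T l \<omega> i - T k \<omega> i))" .
      qed
      finally show ?thesis using False by simp
    qed simp
    have m: "(\<lambda>\<omega>. if l = k then 0 else ?c k \<omega> * (\<Prod>i<n. g (T l \<omega> i - T k \<omega> i))) \<in> borel_measurable M" for k l
    proof (cases "l = k")
      case False
      have [measurable]: "(\<lambda>\<omega>. g (T l \<omega> i - T k \<omega> i)) \<in> borel_measurable M" if "i \<in> {..<n}" for i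
        using that by (intro measurable_compose[OF _ g_meas] borel_measurable_diff comp) auto
      show ?thesis using False by simp
    qed simp
    show ?thesis
      by (subst (1 2) nn_integral_suminf, use m in measurable, subst (1 2) nn_integral_suminf)
         (use m eq in auto)
  qed
  also have "\<dots> \<le> (\<integral>\<^sup>+\<omega>. pair_dominator g C \<omega> \<partial>M)"
    by (rule nn_integral_mono_AE, use AE_enumeration AE_space in eventually_elim)
       (use C in \<open>auto intro: sum_pairs_le_pair_dominator\<close>)
  also have "\<dots> \<le> C ^ (2 * n) * ennreal (lam\<^sup>2) * (\<integral>\<^sup>+u. g u \<partial>lborel) ^ n"
    using C g_meas by (intro nn_integral_pair_dominator_le)
  finally show ?thesis
    unfolding error_prob_def palm_prob_def by (intro divide_right_mono_ennreal add_left_mono) simp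
qed

end

section \<open>Chernoff bounds for Laplace noise\<close>

declare euc_component_measurable [measurable del]
  \<comment> \<open>higher-order matching would make it capture functions that are not points\<close>

lemma ennreal_inverse_antimono: "b \<le> c \<Longrightarrow> inverse c \<le> inverse (b :: ennreal)"
  using ereal_inverse_antimono[of "enn2ereal b" "enn2ereal c"]
  by (simp add: less_eq_ennreal.rep_eq inverse_ennreal.rep_eq)

text \<open>The constant costs only \<open>ln K / n\<close>. An error probability equal to 0 is
  treated apart, since \<open>neg_ln\<close> is then infinite.\<close>

lemma error_exponent_ge:
  assumes ev: "\<forall>\<^sub>F n in sequentially. p n \<le> ennreal (K * exp (- (real n * E)))" and K: "K > 0"
  shows "ereal E \<le> error_exponent p"
proof -
  have lim: "(\<lambda>n. ereal (E - ln K / real n)) \<longlonglongrightarrow> ereal E"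
    unfolding lim_ereal by real_asymp
  have "\<forall>\<^sub>F n in sequentially. ereal (E - ln K / real n) \<le> neg_ln (p n) / ereal (real n)"
    using ev eventually_gt_at_top[of 0]
  proof eventually_elim
    case (elim n)
    show ?case
    proof (cases "p n = 0")
      case True
      with elim show ?thesis by (simp add: neg_ln_def)
    next
      case False
      have "p n < \<infinity>" using elim(1) by (auto intro: le_less_trans)
      then obtain x where x: "p n = ennreal x" "x > 0"
        using False by (cases "p n") (auto simp: less_le)
      have "ln x \<le> ln (K * exp (- (real n * E)))"
        using elim(1) x K by (subst ln_le_cancel_iff) auto
      then have "real n * E - ln K \<le> - ln x"
        using K by (simp add: ln_mult)
      then have "(real n * E - ln K) / real n \<le> - ln x / real n"
        using elim(2) by (intro divide_right_mono) auto
      then have "E - ln K / real n \<le> - ln x / real n"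
        using elim(2) by (simp add: diff_divide_distrib)
      then show ?thesis using x elim(2) by (simp add: neg_ln_def)
    qed
  qed
  then have "liminf (\<lambda>n. ereal (E - ln K / real n)) \<le> error_exponent p"
    unfolding error_exponent_def by (rule Liminf_mono)
  then show ?thesis using lim_imp_Liminf[OF _ lim] by simp
qed

text \<open>A Lipschitz exponent survives averaging over the noise as a constant factor, which
  supplies the rounding constant \<open>C\<close> required by the union bound.\<close>

lemma exp_lipschitz_nn_integral:
  fixes h :: "real \<Rightarrow> real \<Rightarrow> real"
  assumes "\<And>x. h x u \<le> h x v + c" and [measurable]: "(\<lambda>x. f x * ennreal (exp (h x v))) \<in> borel_measurable lborel"
  shows "(\<integral>\<^sup>+x. f x * ennreal (exp (h x u)) \<partial>lborel) \<le> ennreal (exp c) * (\<integral>\<^sup>+x. f x * ennreal (exp (h x v)) \<partial>lborel)"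
proof -
  have "(\<integral>\<^sup>+x. f x * ennreal (exp (h x u)) \<partial>lborel) \<le> (\<integral>\<^sup>+x. ennreal (exp c) * (f x * ennreal (exp (h x v))) \<partial>lborel)"
  proof (intro nn_integral_mono)
    fix x
    have "ennreal (exp (h x u)) \<le> ennreal (exp c * exp (h x v))"
      using assms(1)[of x] by (simp add: exp_add[symmetric] add.commute)
    then have "f x * ennreal (exp (h x u)) \<le> f x * (ennreal (exp c) * ennreal (exp (h x v)))"
      by (intro mult_left_mono) (auto simp: ennreal_mult)
    then show "f x * ennreal (exp (h x u)) \<le> ennreal (exp c) * (f x * ennreal (exp (h x v)))"
      by (simp only: mult.left_commute)
  qed
  also have "\<dots> = ennreal (exp c) * (\<integral>\<^sup>+x. f x * ennreal (exp (h x v)) \<partial>lborel)"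
    by (rule nn_integral_cmult) fact
  finally show ?thesis .
qed

lemma prod_ennreal_exp:
  fixes h :: "nat \<Rightarrow> real"
  shows "(\<Prod>i<n. ennreal (exp (h i))) = ennreal (exp (\<Sum>i<n. h i))"
  by (subst exp_sum) (auto simp: prod_ennreal)

locale laplace_matern_process =
  marked_matern_process M n lam \<Phi> r T D "\<lambda>x. ennreal (\<beta> / 2 * exp (- (\<beta> * \<bar>x\<bar>)))"
  for M :: "'w measure" and n lam \<Phi> r T D and \<beta> :: real +
  assumes \<beta>_pos: "\<beta> > 0"
begin

text \<open>\<open>\<beta> / a\<close> is the \<open>s\<close> minimising
  \<open>exp (s * a / \<beta>) * (2 / s)\<close>, the one-coordinate exponential bound for the
  volume of the ball of radius \<open>n * a / \<beta>\<close>. The resulting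
  \<open>(2 * exp 1 * a / \<beta>) ^ n\<close> stands in for the exact volume
  \<open>(2 * r) ^ n / fact n\<close>.\<close>

lemma lam_le_intensity_add_exp:
  assumes a: "a > 0" and r: "r = real n * a / \<beta>"
  shows "ennreal lam \<le> intensity M n T + ennreal (exp (2 * \<beta> / a) * lam\<^sup>2 * (2 * exp 1 * a / \<beta>) ^ n)"
proof -
  let ?g = "\<lambda>u. ennreal (exp (1 - \<beta> / a * \<bar>u\<bar>))" and ?C = "ennreal (exp (\<beta> / a / real n))"
  have "ennreal lam \<le> intensity M n T + ?C ^ (2 * n) * ennreal (lam\<^sup>2) * (\<integral>\<^sup>+u. ?g u \<partial>lborel) ^ n"
  proof (rule lam_le_intensity_add)
    fix u v :: real assume "\<bar>u - v\<bar> \<le> 1 / real n"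
    then have "\<beta> / a * (\<bar>v\<bar> - \<bar>u\<bar>) \<le> \<beta> / a * (1 / real n)"
      using \<beta>_pos a by (intro mult_left_mono) auto
    then show "?g u \<le> ?C * ?g v"
      by (simp add: ennreal_mult'[symmetric] exp_add[symmetric] algebra_simps)
  next
    fix y assume y: "norm1 n y < r"
    have "\<beta> / a * norm1 n y \<le> \<beta> / a * r"
      using y \<beta>_pos a by (intro mult_left_mono) auto
    then have "0 \<le> real n - \<beta> / a * norm1 n y"
      using r \<beta>_pos a by simp
    then show "1 \<le> (\<Prod>i<n. ?g (y i))"
      unfolding prod_ennreal_exp by (simp add: norm1_def sum_subtractf sum_distrib_left)
  qed simp
  also have "?C ^ (2 * n) = ennreal (exp (2 * \<beta> / a))"
    using n_pos by (simp add: ennreal_power exp_of_nat_mult[symmetric] del: exp_of_nat_mult)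
  also have "(\<integral>\<^sup>+u. ?g u \<partial>lborel) = (\<integral>\<^sup>+u. ennreal (exp 1) * ennreal (exp (- (\<beta> / a * \<bar>u\<bar>))) \<partial>lborel)"
    by (simp add: ennreal_mult'[symmetric] exp_add[symmetric])
  also have "\<dots> = ennreal (exp 1) * ennreal (2 / (\<beta> / a))"
    using \<beta>_pos a by (subst nn_integral_cmult) (simp_all only: nn_integral_exp_abs divide_pos_pos, simp_all)
  also have "\<dots> = ennreal (2 * exp 1 * a / \<beta>)"
    using \<beta>_pos a by (simp add: ennreal_mult'[symmetric] mult_ac)
  also have "ennreal (exp (2 * \<beta> / a)) * ennreal (lam\<^sup>2) * ennreal (2 * exp 1 * a / \<beta>) ^ n
      = ennreal (exp (2 * \<beta> / a) * lam\<^sup>2 * (2 * exp 1 * a / \<beta>) ^ n)"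
    using \<beta>_pos a by (simp add: ennreal_mult' ennreal_power)
  finally show ?thesis .
qed

text \<open>\<open>m\<close> is the multiplier of the competitor's distance to \<open>d\<close>,
  \<open>t\<close> that of the exclusion constraint, and \<open>c\<close> the allowance per
  coordinate. The coefficient \<open>\<beta> - m\<close> of \<open>norm1 n d\<close> turns the decay
  rate \<open>\<beta>\<close> of the noise into \<open>m\<close>, so that the integral over the
  noise has the symmetric exponent \<open>m * (|x| + |u - x|)\<close>; \<open>t < m\<close> makes
  the integral over \<open>u\<close> converge.\<close>

lemma error_prob_exp_bound:
  assumes A: "A \<in> sets (euc n)" and m: "0 \<le> t" "t < m"
    and cover: "\<And>d y. d \<in> space (euc n) \<Longrightarrow> d \<notin> A \<Longrightarrow> norm1 n (vdiff n d y) \<le> norm1 n d \<Longrightarrow> r \<le> norm1 n y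
      \<Longrightarrow> 0 \<le> real n * c + (\<beta> - m) * norm1 n d - m * norm1 n (vdiff n d y) + t * norm1 n y"
    and lam: "lam > 0" and I: "ennreal (lam / 2) \<le> intensity M n T"
  shows "error_prob M n T D \<le> emeasure noise A
    + ennreal (2 * exp (2 * (m + t)) * (lam * (\<beta> * exp c * (1 / (m - t)\<^sup>2 + 1 / (m * (m - t)))) ^ n))"
proof -
  let ?f = "\<lambda>x. ennreal (\<beta> / 2 * exp (- (\<beta> * \<bar>x\<bar>)))"
  let ?h = "\<lambda>x u. c + (\<beta> - m) * \<bar>x\<bar> - m * \<bar>u - x\<bar> + t * \<bar>u\<bar>"
  let ?g = "\<lambda>u. \<integral>\<^sup>+x. ?f x * ennreal (exp (?h x u)) \<partial>lborel"
  let ?C = "ennreal (exp ((m + t) / real n))"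
  let ?J = "\<beta> * exp c * (1 / (m - t)\<^sup>2 + 1 / (m * (m - t)))" and ?K = "exp (2 * (m + t))"
  have J: "?J \<ge> 0" using \<beta>_pos m by simp
  have gJ: "(\<integral>\<^sup>+u. ?g u \<partial>lborel) \<le> ennreal ?J"
  proof -
    have "?g u \<le> ennreal (\<beta> / 2 * exp c) * ennreal ((\<bar>u\<bar> + 1 / m) * exp (- ((m - t) * \<bar>u\<bar>)))" for u
    proof -
      have "?g u = (\<integral>\<^sup>+x. ennreal (\<beta> / 2 * exp (c + t * \<bar>u\<bar>)) * ennreal (exp (- (2 * m * (\<bar>x\<bar> + \<bar>u - x\<bar>) / 2))) \<partial>lborel)"
        using \<beta>_pos by (intro nn_integral_cong) (simp add: ennreal_mult'[symmetric] exp_add[symmetric] algebra_simps)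
      also have "\<dots> = ennreal (\<beta> / 2 * exp (c + t * \<bar>u\<bar>)) * (\<integral>\<^sup>+x. ennreal (exp (- (2 * m * (\<bar>x\<bar> + \<bar>u - x\<bar>) / 2))) \<partial>lborel)"
        by (rule nn_integral_cmult) measurable
      also have "\<dots> \<le> ennreal (\<beta> / 2 * exp (c + t * \<bar>u\<bar>)) * ennreal ((\<bar>u\<bar> + 2 / (2 * m)) * exp (- (2 * m * \<bar>u\<bar> / 2)))"
        using m by (intro mult_left_mono nn_integral_exp_dist_le) auto
      also have "\<dots> = ennreal (\<beta> / 2 * exp c) * ennreal ((\<bar>u\<bar> + 1 / m) * exp (- ((m - t) * \<bar>u\<bar>)))"
        using \<beta>_pos m by (simp add: ennreal_mult'[symmetric] exp_add exp_diff exp_minus field_simps)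
      finally show ?thesis .
    qed
    then have "(\<integral>\<^sup>+u. ?g u \<partial>lborel) \<le> (\<integral>\<^sup>+u. ennreal (\<beta> / 2 * exp c) * ennreal ((\<bar>u\<bar> + 1 / m) * exp (- ((m - t) * \<bar>u\<bar>))) \<partial>lborel)"
      by (intro nn_integral_mono)
    also have "\<dots> = ennreal (\<beta> / 2 * exp c) * ennreal (2 / (m - t)\<^sup>2 + 2 * (1 / m) / (m - t))"
      using m by (subst nn_integral_cmult) (simp_all add: nn_integral_abs_exp_abs)
    also have "\<dots> = ennreal ?J"
      using \<beta>_pos m by (subst ennreal_mult'[symmetric]) (simp_all add: distrib_left)
    finally show ?thesis .
  qed
  have "error_prob M n T D \<le> (intensity M n T * emeasure noise A
     + ?C ^ (2 * n) * ennreal (lam\<^sup>2) * (\<integral>\<^sup>+u. ?g u \<partial>lborel) ^ n) / intensity M n T"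
  proof (rule error_prob_union_bound[OF A, where \<eta>="\<lambda>x u. ennreal (exp (?h x u))"])
    fix d y assume *: "d \<in> space (euc n)" "d \<notin> A" "norm1 n (vdiff n d y) \<le> norm1 n d" "r \<le> norm1 n y"
    have "(\<Sum>i<n. ?h (d i) (y i)) = real n * c + (\<beta> - m) * norm1 n d - m * norm1 n (vdiff n y d) + t * norm1 n y"
      by (simp add: norm1_def vdiff_def sum.distrib sum_subtractf sum_distrib_left)
    then show "1 \<le> (\<Prod>i<n. ennreal (exp (?h (d i) (y i))))"
      unfolding prod_ennreal_exp using cover[OF *] by (simp add: norm1_vdiff_commute[of n y d])
  next
    fix u v :: real assume uv: "\<bar>u - v\<bar> \<le> 1 / real n"
    show "?g u \<le> ?C * ?g v"
    proof (rule exp_lipschitz_nn_integral)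
      fix x
      have "m * (\<bar>v - x\<bar> - \<bar>u - x\<bar>) \<le> m * (1 / real n)" "t * (\<bar>u\<bar> - \<bar>v\<bar>) \<le> t * (1 / real n)"
        using m uv by (intro mult_left_mono; linarith)+
      then show "?h x u \<le> ?h x v + (m + t) / real n"
        by (simp add: algebra_simps add_divide_distrib)
    qed simp
  qed simp_all
  also have "?C ^ (2 * n) = ennreal ?K"
    using n_pos by (simp add: ennreal_power exp_of_nat_mult[symmetric] del: exp_of_nat_mult)
  also have "(intensity M n T * emeasure noise A + ennreal ?K * ennreal (lam\<^sup>2) * (\<integral>\<^sup>+u. ?g u \<partial>lborel) ^ n) / intensity M n T
    = intensity M n T * emeasure noise A / intensity M n T
       + ennreal ?K * ennreal (lam\<^sup>2) * (\<integral>\<^sup>+u. ?g u \<partial>lborel) ^ n / intensity M n T"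
    by (rule add_divide_distrib_ennreal)
  \<comment> \<open>Dividing \<open>lam^2\<close> by an intensity of at least \<open>lam / 2\<close>
    leaves \<open>2 * lam\<close>: one power of \<open>lam\<close> belongs to the typical point, the
    other to its competitor.\<close>
  also have "\<dots> \<le> emeasure noise A + ennreal ?K * ennreal (lam\<^sup>2) * ennreal ?J ^ n / ennreal (lam / 2)"
  proof (intro add_mono)
    have "intensity M n T \<noteq> \<infinity>" using intensity_le by (auto simp: top_unique)
    moreover have "intensity M n T \<noteq> 0" using I lam by auto
    ultimately show "intensity M n T * emeasure noise A / intensity M n T \<le> emeasure noise A"
      by (subst mult.commute, subst ennreal_mult_divide_eq) auto
    show "ennreal ?K * ennreal (lam\<^sup>2) * (\<integral>\<^sup>+u. ?g u \<partial>lborel) ^ n / intensity M n T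
       \<le> ennreal ?K * ennreal (lam\<^sup>2) * ennreal ?J ^ n / ennreal (lam / 2)"
      unfolding divide_ennreal_def
      by (intro mult_mono power_mono gJ ennreal_inverse_antimono I) auto
  qed
  also have "ennreal ?K * ennreal (lam\<^sup>2) * ennreal ?J ^ n / ennreal (lam / 2) = ennreal (2 * ?K * (lam * ?J ^ n))"
  proof -
    have "ennreal ?K * ennreal (lam\<^sup>2) * ennreal ?J ^ n = ennreal (?K * lam\<^sup>2 * ?J ^ n)"
      using J by (simp only: ennreal_power) (simp add: ennreal_mult')
    moreover have "?K * lam\<^sup>2 * ?J ^ n / (lam / 2) = 2 * ?K * (lam * ?J ^ n)"
      using lam by (simp add: power2_eq_square)
    moreover have "0 \<le> ?K * lam\<^sup>2 * ?J ^ n" using J by simp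
    ultimately show ?thesis using lam by (simp only: divide_ennreal half_gt_zero_iff)
  qed
  finally show ?thesis .
qed

text \<open>Exponential Markov inequality with parameter \<open>\<tau> * \<beta>\<close>; the moment
  generating function of the absolute value of a Laplace variable of rate \<open>\<beta>\<close> is
  there \<open>1 / (1 - \<tau>)\<close>.\<close>

lemma noise_tail:
  assumes \<tau>: "0 \<le> \<tau>" "\<tau> < 1"
  shows "emeasure noise {d \<in> space (euc n). real n * \<alpha> / \<beta> \<le> norm1 n d} \<le> ennreal ((exp (- (\<tau> * \<alpha>)) / (1 - \<tau>)) ^ n)"
proof -
  let ?A = "{d \<in> space (euc n). real n * \<alpha> / \<beta> \<le> norm1 n d}"
  let ?k = "\<lambda>x. ennreal (exp (\<tau> * \<beta> * \<bar>x\<bar> - \<tau> * \<alpha>))"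
  have A: "?A \<in> sets noise" unfolding sets_noise by measurable
  have "emeasure noise ?A = (\<integral>\<^sup>+d. indicator ?A d \<partial>noise)" using A by simp
  also have "\<dots> \<le> (\<integral>\<^sup>+d. (\<Prod>i<n. ?k (d i)) \<partial>noise)"
  proof (intro nn_integral_mono)
    fix d
    show "indicator ?A d \<le> (\<Prod>i<n. ?k (d i))"
    proof (cases "d \<in> ?A")
      case True
      then have "\<tau> * \<beta> * (real n * \<alpha> / \<beta>) \<le> \<tau> * \<beta> * norm1 n d"
        using \<tau> \<beta>_pos by (intro mult_left_mono) auto
      then have "0 \<le> (\<Sum>i<n. \<tau> * \<beta> * \<bar>d i\<bar> - \<tau> * \<alpha>)"
        using \<beta>_pos by (simp add: norm1_def sum_subtractf sum_distrib_left mult_ac)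
      then show ?thesis unfolding prod_ennreal_exp by (simp add: indicator_def)
    qed simp
  qed
  also have "\<dots> = (\<Prod>i<n. \<integral>\<^sup>+x. ennreal (\<beta> / 2 * exp (- (\<beta> * \<bar>x\<bar>))) * ?k x \<partial>lborel)"
    by (intro nn_integral_noise_prod) measurable
  also have "(\<integral>\<^sup>+x. ennreal (\<beta> / 2 * exp (- (\<beta> * \<bar>x\<bar>))) * ?k x \<partial>lborel)
    = (\<integral>\<^sup>+x. ennreal (\<beta> / 2 * exp (- (\<tau> * \<alpha>))) * ennreal (exp (- ((1 - \<tau>) * \<beta> * \<bar>x\<bar>))) \<partial>lborel)"
    using \<beta>_pos by (intro nn_integral_cong) (simp add: ennreal_mult'[symmetric] exp_add[symmetric] algebra_simps)
  also have "\<dots> = ennreal (\<beta> / 2 * exp (- (\<tau> * \<alpha>))) * ennreal (2 / ((1 - \<tau>) * \<beta>))"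
    using \<tau> \<beta>_pos by (subst nn_integral_cmult) (simp_all add: nn_integral_exp_abs)
  also have "\<dots> = ennreal (exp (- (\<tau> * \<alpha>)) / (1 - \<tau>))"
    using \<tau> \<beta>_pos by (subst ennreal_mult'[symmetric]) (simp_all add: field_simps)
  finally show ?thesis using \<tau> by (simp add: ennreal_power)
qed

end

section \<open>Choice of the multipliers in the three regimes of \<open>\<alpha>\<close>\<close>

theorem mainTheorem7:
  fixes \<sigma> \<alpha> \<epsilon> R :: real
    and lam r :: "nat \<Rightarrow> real"
    and M :: "nat \<Rightarrow> 'w measure"
    and \<Phi> :: "nat \<Rightarrow> 'w \<Rightarrow> pt set"
    and T D :: "nat \<Rightarrow> nat \<Rightarrow> 'w \<Rightarrow> pt"
  assumes "\<sigma> > 0" and "\<alpha> > 1" and "\<epsilon> > 0" and "\<epsilon> < \<alpha>"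
    and eps_small: "\<alpha> > 4 \<longrightarrow> \<epsilon> \<le> 1"
    and R: "R = - ln (sqrt 2 * exp 1 * \<sigma> * \<alpha>)"
    and lam: "\<And>n. lam n = exp (real n * R)"
    and r: "\<And>n. r n = real n * \<sigma> / sqrt 2 * (\<alpha> - \<epsilon>)"
    and "\<And>n. n > 0 \<Longrightarrow> prob_space (M n)"
    and "\<And>n. n > 0 \<Longrightarrow> poisson_process (M n) n (lam n) (\<Phi> n)"
    and "\<And>n. n > 0 \<Longrightarrow> enumeration (M n) n (T n) (\<lambda>\<omega>. matern n (r n) (\<Phi> n \<omega>))"
    and "\<And>n. n > 0 \<Longrightarrow> iid_marks (M n) n (T n) (D n) (sym_exp_noise n \<sigma>)"
  defines "exponent \<equiv> error_exponent (\<lambda>n. error_prob (M n) n (T n) (D n))"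
  shows "(\<alpha> \<le> 2 \<longrightarrow> exponent \<ge> ereal (\<alpha> - ln \<alpha> - 1)) \<and>
         (2 \<le> \<alpha> \<and> \<alpha> \<le> 4 \<longrightarrow> exponent \<ge> ereal (ln \<alpha> + 1 - 2 * ln 2)) \<and>
         (\<alpha> \<ge> 4 \<longrightarrow> exponent \<ge> ereal (\<alpha> / 2 - ln \<alpha> - 1 + 2 * ln 2))"
proof -
  define \<beta> a where "\<beta> = sqrt 2 / \<sigma>" and "a = \<alpha> - \<epsilon>"
  have \<beta>: "\<beta> > 0" and a: "0 < a" "a < \<alpha>" and \<alpha>: "\<alpha> > 1"
    using assms(1-4) by (auto simp: \<beta>_def a_def)
  have dens: "sym_exp_density \<sigma> = (\<lambda>x. \<beta> / 2 * exp (- (\<beta> * \<bar>x\<bar>)))"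
    by (simp add: sym_exp_density_def \<beta>_def fun_eq_iff)
  have rad: "r n = real n * a / \<beta>" for n
    unfolding r using assms(1) by (simp add: \<beta>_def a_def)
  have lam_pow: "lam n = (\<beta> / (2 * exp 1 * \<alpha>)) ^ n" for n
  proof -
    have "exp R = inverse (sqrt 2 * exp 1 * \<sigma> * \<alpha>)"
      unfolding R using assms(1) \<alpha> by (simp add: exp_minus)
    also have "\<dots> = \<beta> / (2 * exp 1 * \<alpha>)"
      using assms(1) \<alpha> by (simp add: \<beta>_def field_simps)
    finally show ?thesis
      unfolding lam exp_of_nat_mult by simp
  qed
  have lam_pos: "lam n > 0" for n
    by (simp add: lam)
  have process: "laplace_matern_process (M n) n (lam n) (\<Phi> n) (r n) (T n) (D n) \<beta>" if "n > 0" for n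
  proof -
    have "(\<integral>\<^sup>+x. ennreal (\<beta> / 2 * exp (- (\<beta> * \<bar>x\<bar>))) \<partial>lborel)
      = (\<integral>\<^sup>+x. ennreal (\<beta> / 2) * ennreal (exp (- (\<beta> * \<bar>x\<bar>))) \<partial>lborel)"
      using \<beta> by (intro nn_integral_cong ennreal_mult') simp
    also have "\<dots> = ennreal (\<beta> / 2) * ennreal (2 / \<beta>)"
      using \<beta> by (subst nn_integral_cmult) (simp_all add: nn_integral_exp_abs)
    also have "\<dots> = 1"
      using \<beta> by (subst ennreal_mult'[symmetric]) simp_all
    finally have "prob_space (density lborel (\<lambda>x. ennreal (\<beta> / 2 * exp (- (\<beta> * \<bar>x\<bar>)))))"
      by (intro prob_spaceI) (simp add: emeasure_density)
    then show ?thesis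
      using assms(9-12)[OF that] lam_pos[of n] that \<beta>
      by (auto simp: laplace_matern_process_def laplace_matern_process_axioms_def marked_matern_process_def
          marked_matern_process_axioms_def matern_process_def matern_process_axioms_def
          poisson_points_def poisson_points_axioms_def sym_exp_noise_def dens)
  qed
  have intens: "\<forall>\<^sub>F n in sequentially. n > 0 \<and> ennreal (lam n / 2) \<le> intensity (M n) n (T n)"
  proof -
    let ?K = "exp (2 * \<beta> / a)"
    \<comment> \<open>\<open>\<epsilon> > 0\<close> enters here through \<open>a < \<alpha>\<close>:
      the expected number of close neighbours of a point decays geometrically.\<close>
    have "(\<lambda>n. (a / \<alpha>) ^ n) \<longlonglongrightarrow> 0"
      using a \<alpha> by (intro LIMSEQ_realpow_zero) auto
    then have "(\<lambda>n. ?K * (a / \<alpha>) ^ n) \<longlonglongrightarrow> 0"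
      by (rule tendsto_mult_right_zero)
    \<comment> \<open>Any fixed positive fraction of \<open>lam n\<close> would do as a lower bound
      for the intensity, since constants disappear from the exponent.\<close>
    then have "\<forall>\<^sub>F n in sequentially. ?K * (a / \<alpha>) ^ n < 1 / 2"
      by (rule order_tendstoD) simp
    then show ?thesis using eventually_gt_at_top[of 0]
    proof eventually_elim
      case (elim n)
      interpret laplace_matern_process "M n" n "lam n" "\<Phi> n" "r n" "T n" "D n" \<beta>
        using elim(2) by (rule process)
      have "lam n * (2 * exp 1 * a / \<beta>) ^ n = (a / \<alpha>) ^ n"
        unfolding lam_pow power_mult_distrib[symmetric] using \<beta> \<alpha> by (simp add: field_simps)
      then have "?K * (lam n)\<^sup>2 * (2 * exp 1 * a / \<beta>) ^ n = lam n * (?K * (a / \<alpha>) ^ n)"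
        by (simp add: power2_eq_square algebra_simps)
      also have "\<dots> \<le> lam n * (1 / 2)"
        using elim(1) lam_pos[of n] by (intro mult_left_mono) auto
      finally have "ennreal (?K * (lam n)\<^sup>2 * (2 * exp 1 * a / \<beta>) ^ n) \<le> ennreal (lam n / 2)"
        by (intro ennreal_leI) simp
      with lam_le_intensity_add_exp[OF a(1) rad]
      have le: "ennreal (lam n) \<le> intensity (M n) n (T n) + ennreal (lam n / 2)"
        by (meson add_left_mono order_trans)
      have "ennreal (lam n / 2) \<le> intensity (M n) n (T n)"
      proof (cases "intensity (M n) n (T n)")
        case (real x)
        with le lam_pos[of n] have "ennreal (lam n) \<le> ennreal (x + lam n / 2)" by simp
        then have "lam n \<le> x + lam n / 2"
          using real lam_pos[of n] by (subst (asm) ennreal_le_iff) auto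
        then show ?thesis using real by (simp add: ennreal_leI)
      qed simp
      with elim(2) show ?case by simp
    qed
  qed
  \<comment> \<open>\<open>t\<close> is the multiplier of the exclusion constraint \<open>norm1 n y \<ge> r n\<close>.\<close>
  have chernoff: "ereal (1 + ln (2 * \<alpha>) + t * a - ln (1 / (1 / 2 - t)\<^sup>2 + 2 / (1 / 2 - t))) \<le> exponent"
    if t: "0 \<le> t" "t < 1 / 2" for t
  proof -
    define q where "q = 1 / 2 - t"
    define X where "X = 1 / q\<^sup>2 + 2 / q"
    define E where "E = 1 + ln (2 * \<alpha>) + t * a - ln X"
    have q: "q > 0" using t by (simp add: q_def)
    then have X: "X > 0" by (simp add: X_def add_pos_pos)
    have "exp (- E) = exp (ln X) * exp (- (t * a)) / (exp 1 * exp (ln (2 * \<alpha>)))"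
      unfolding E_def by (simp add: exp_add[symmetric] exp_diff[symmetric])
    then have expE: "exp (- E) = X * exp (- (t * a)) / (2 * exp 1 * \<alpha>)"
      using X \<alpha> by simp
    have "\<forall>\<^sub>F n in sequentially. error_prob (M n) n (T n) (D n)
        \<le> ennreal (2 * exp (2 * (\<beta> / 2 + t * \<beta>)) * exp (- (real n * E)))"
      using intens
    proof eventually_elim
      case (elim n)
      interpret laplace_matern_process "M n" n "lam n" "\<Phi> n" "r n" "T n" "D n" \<beta>
        using elim by (intro process) simp
      let ?J = "\<beta> * exp (- (t * a)) * (1 / (\<beta> / 2 - t * \<beta>)\<^sup>2 + 1 / (\<beta> / 2 * (\<beta> / 2 - t * \<beta>)))"
      have bq: "\<beta> / 2 - t * \<beta> = \<beta> * q" by (simp add: q_def algebra_simps)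
      \<comment> \<open>\<open>m = \<beta> / 2\<close>, with \<open>A\<close> empty: as
        \<open>norm1 n d\<close> is unbounded, its net coefficient \<open>\<beta> - 2 * m\<close>
        must not be negative, and the bound improves as \<open>m\<close> grows. At this
        \<open>m\<close> the noise length cancels and only the exclusion gain
        \<open>c = - (t * a)\<close> is left.\<close>
      have "error_prob (M n) n (T n) (D n) \<le> emeasure noise {} + ennreal (2 * exp (2 * (\<beta> / 2 + t * \<beta>)) * (lam n * ?J ^ n))"
      proof (rule error_prob_exp_bound)
        fix d y assume "norm1 n (vdiff n d y) \<le> norm1 n d" "r n \<le> norm1 n y"
        then have "\<beta> / 2 * norm1 n (vdiff n d y) \<le> \<beta> / 2 * norm1 n d" "t * \<beta> * r n \<le> t * \<beta> * norm1 n y"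
          using \<beta> t by (intro mult_left_mono; simp)+
        moreover have "t * \<beta> * r n = real n * (t * a)"
          unfolding rad using \<beta> by simp
        ultimately show "0 \<le> real n * (- (t * a)) + (\<beta> - \<beta> / 2) * norm1 n d - \<beta> / 2 * norm1 n (vdiff n d y) + t * \<beta> * norm1 n y"
          by simp
      qed (use elim \<beta> t lam_pos in \<open>auto simp: field_simps\<close>)
      also have "lam n * ?J ^ n = exp (- (real n * E))"
      proof -
        have "\<beta> / (2 * exp 1 * \<alpha>) * ?J = exp (- E)"
          unfolding expE bq X_def using \<beta> \<alpha> q by (simp add: field_simps power2_eq_square)
        then show ?thesis
          unfolding lam_pow power_mult_distrib[symmetric] by (simp add: exp_of_nat_mult[symmetric])
      qed
      finally show ?case by simp
    qed
    then have "ereal E \<le> exponent"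
      unfolding exponent_def by (rule error_exponent_ge) simp
    then show ?thesis by (simp add: E_def X_def q_def)
  qed
  \<comment> \<open>Noise longer than \<open>n \<alpha> / \<beta>\<close> is counted as an error outright; \<open>c = 2 - \<alpha>\<close> is the multiplier of the
    opposite constraint, which is why \<open>\<alpha> \<le> 2\<close> is needed.\<close>
  have small: "ereal (\<alpha> - ln \<alpha> - 1) \<le> exponent" if "\<alpha> \<le> 2"
  proof -
    define E where "E = \<alpha> - ln \<alpha> - 1"
    have expE: "exp (- E) = \<alpha> * exp (1 - \<alpha>)"
      using \<alpha> by (simp add: E_def exp_diff exp_add exp_minus field_simps)
    have "\<forall>\<^sub>F n in sequentially. error_prob (M n) n (T n) (D n)
        \<le> ennreal ((1 + 2 * exp (2 * (\<beta> / \<alpha>))) * exp (- (real n * E)))"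
      using intens
    proof eventually_elim
      case (elim n)
      interpret laplace_matern_process "M n" n "lam n" "\<Phi> n" "r n" "T n" "D n" \<beta>
        using elim by (intro process) simp
      \<comment> \<open>\<open>m = \<beta> / \<alpha>\<close>: covering noise up to length
        \<open>n * \<alpha> / \<beta>\<close> requires
        \<open>c = (2 * m - \<beta>) * \<alpha> / \<beta>\<close>, and this \<open>m\<close> then
        minimises \<open>exp c / m^2\<close>. The net coefficient of \<open>norm1 n d\<close> is now
        nonpositive.\<close>
      let ?J = "\<beta> * exp (2 - \<alpha>) * (1 / (\<beta> / \<alpha> - 0)\<^sup>2 + 1 / (\<beta> / \<alpha> * (\<beta> / \<alpha> - 0)))"
      \<comment> \<open>At this radius the bound \<open>(2 * exp 1 * \<alpha> / \<beta>) ^ n\<close>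
        for the volume of the ball equals \<open>1 / lam n\<close>: this is the scale at which
        competitors become typical.\<close>
      let ?A = "{d \<in> space (euc n). real n * \<alpha> / \<beta> \<le> norm1 n d}"
      have "error_prob (M n) n (T n) (D n) \<le> emeasure noise ?A + ennreal (2 * exp (2 * (\<beta> / \<alpha> + 0)) * (lam n * ?J ^ n))"
      proof (rule error_prob_exp_bound)
        fix d y assume d: "d \<in> space (euc n)" "d \<notin> ?A" "norm1 n (vdiff n d y) \<le> norm1 n d"
        have "\<beta> / \<alpha> * norm1 n (vdiff n d y) \<le> \<beta> / \<alpha> * norm1 n d"
          using \<beta> \<alpha> d by (intro mult_left_mono) auto
        moreover have "\<beta> / \<alpha> * (2 - \<alpha>) * norm1 n d \<le> \<beta> / \<alpha> * (2 - \<alpha>) * (real n * \<alpha> / \<beta>)"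
          using d \<beta> \<alpha> that by (intro mult_left_mono) auto
        moreover have "\<beta> / \<alpha> * (2 - \<alpha>) * (real n * \<alpha> / \<beta>) = real n * (2 - \<alpha>)"
          using \<beta> \<alpha> by simp
        moreover have "(\<beta> - \<beta> / \<alpha>) * norm1 n d - \<beta> / \<alpha> * norm1 n d = - (\<beta> / \<alpha> * (2 - \<alpha>) * norm1 n d)"
          using \<alpha> by (simp add: field_simps)
        ultimately show "0 \<le> real n * (2 - \<alpha>) + (\<beta> - \<beta> / \<alpha>) * norm1 n d - \<beta> / \<alpha> * norm1 n (vdiff n d y) + 0 * norm1 n y"
          by linarith
      qed (use elim \<beta> \<alpha> lam_pos in auto)
      also have "lam n * ?J ^ n = exp (- (real n * E))"
      proof -
        have "exp (2 - \<alpha>) = exp 1 * exp (1 - \<alpha>)"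
          by (simp add: exp_add[symmetric])
        then have "\<beta> / (2 * exp 1 * \<alpha>) * ?J = exp (- E)"
          unfolding expE using \<beta> \<alpha> by (simp add: field_simps power2_eq_square)
        then show ?thesis
          unfolding lam_pow power_mult_distrib[symmetric] by (simp add: exp_of_nat_mult[symmetric])
      qed
      \<comment> \<open>\<open>\<tau> = 1 - 1 / \<alpha>\<close> minimises
        \<open>exp (- (\<tau> * \<alpha>)) / (1 - \<tau>)\<close>; the tail then decays at the same
        rate \<open>E\<close> as the competitor term.\<close>
      also have "emeasure noise ?A \<le> ennreal ((exp (- ((1 - 1 / \<alpha>) * \<alpha>)) / (1 - (1 - 1 / \<alpha>))) ^ n)"
        using \<alpha> by (intro noise_tail) auto
      also have "exp (- ((1 - 1 / \<alpha>) * \<alpha>)) / (1 - (1 - 1 / \<alpha>)) = exp (- E)"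
        unfolding expE using \<alpha> by (simp add: algebra_simps)
      also have "exp (- E) ^ n = exp (- (real n * E))"
        by (simp add: exp_of_nat_mult[symmetric])
      also have "ennreal (exp (- (real n * E))) + ennreal (2 * exp (2 * (\<beta> / \<alpha> + 0)) * exp (- (real n * E)))
        = ennreal ((1 + 2 * exp (2 * (\<beta> / \<alpha>))) * exp (- (real n * E)))"
        by (simp add: distrib_right flip: ennreal_plus)
      finally show ?case by simp
    qed
    then show ?thesis
      unfolding exponent_def E_def[symmetric] by (rule error_exponent_ge) (simp add: add_pos_pos)
  qed
  have medium: "ereal (ln \<alpha> + 1 - 2 * ln 2) \<le> exponent"
  proof -
    \<comment> \<open>At \<open>t = 0\<close> the argument of the logarithm in
      \<open>chernoff\<close> is \<open>4 + 4 = 8\<close>.\<close>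
    have "ln (8::real) = 3 * ln 2" using ln_realpow[of 2 3] by simp
    then show ?thesis
      using chernoff[of 0] \<alpha> by (simp add: ln_mult power2_eq_square algebra_simps)
  qed
  have large: "ereal (\<alpha> / 2 - ln \<alpha> - 1 + 2 * ln 2) \<le> exponent" if "\<alpha> > 4"
  proof -
    \<comment> \<open>With \<open>q = 1 / 2 - t\<close>, the choice \<open>q = 2 / \<alpha>\<close>
      maximises \<open>t * \<alpha> - ln (1 / q^2)\<close>, where \<open>1 / q^2\<close> is the
      leading term for small \<open>q\<close>. It gives \<open>t \<ge> 0\<close> because
      \<open>\<alpha> > 4\<close>.\<close>
    let ?t = "1 / 2 - 2 / \<alpha>"
    have t: "0 \<le> ?t" "?t < 1 / 2" using that by (auto simp: field_simps)
    have q: "1 / (1 / 2 - ?t)\<^sup>2 + 2 / (1 / 2 - ?t) = \<alpha>\<^sup>2 / 2 * ((1 + 4 / \<alpha>) / 2)"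
      using that by (simp add: field_simps power2_eq_square)
    \<comment> \<open>The tangent at 1 is exact at \<open>\<alpha> = 4\<close>. Its term
      \<open>2 / \<alpha>\<close> cancels against the one in \<open>?t * (\<alpha> - 1)\<close>, and
      the remaining constants add up to exactly the claimed bound.\<close>
    have "ln ((1 + 4 / \<alpha>) / 2) \<le> (1 + 4 / \<alpha>) / 2 - 1"
      using that by (intro ln_le_minus_one) (simp add: add_pos_pos)
    moreover have "ln (1 / (1 / 2 - ?t)\<^sup>2 + 2 / (1 / 2 - ?t)) = 2 * ln \<alpha> - ln 2 + ln ((1 + 4 / \<alpha>) / 2)"
    proof -
      have "1 + 4 / \<alpha> > 0" using that by (simp add: add_pos_pos)
      then show ?thesis
        unfolding q using that by (subst ln_mult) (auto simp: ln_div ln_realpow)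
    qed
    \<comment> \<open>This is where \<open>\<epsilon> \<le> 1\<close> enters.\<close>
    moreover have "?t * (\<alpha> - 1) \<le> ?t * a"
      using t eps_small that by (intro mult_left_mono) (auto simp: a_def)
    moreover have "?t * (\<alpha> - 1) = \<alpha> / 2 - 5 / 2 + 2 / \<alpha>"
      using that by (simp add: field_simps)
    moreover have "ln (2 * \<alpha>) = ln 2 + ln \<alpha>" using that by (simp add: ln_mult)
    ultimately have "\<alpha> / 2 - ln \<alpha> - 1 + 2 * ln 2
      \<le> 1 + ln (2 * \<alpha>) + ?t * a - ln (1 / (1 / 2 - ?t)\<^sup>2 + 2 / (1 / 2 - ?t))"
      by (simp add: add_divide_distrib)
    then show ?thesis
      using chernoff[OF t] by (meson ereal_less_eq(3) order_trans)
  qed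
  \<comment> \<open>At \<open>\<alpha> = 4\<close> the second and third bounds agree, so the third
    follows there without restricting \<open>\<epsilon>\<close> further.\<close>
  have "ln (4::real) = 2 * ln 2" using ln_realpow[of 2 2] by simp
  then have "ereal (\<alpha> / 2 - ln \<alpha> - 1 + 2 * ln 2) \<le> exponent" if "\<alpha> = 4"
    using medium that by simp
  with small medium large show ?thesis
    by (auto simp: order_le_less)
qed

end
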